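(* Let $(X_k)_{k\ge 0}$ be a Markov chain with transition kernel $P$ on a Polish space $E$ endowed with a complete metric $d$. Suppose there exists $\alpha>0$ such that for all $x,x'\in E$ there exists a coupling $\mathbf{Q}\in\mathcal{C}(\mathbf{P}^x,\mathbf{P}^{x'})$ such that $$\mathbf{Q}\Big[\sum_{n=0}^\infty d(X_n,X_n')^2<\infty\Big]\ge\alpha.$$ Then the Markov chain is weak-* ergodic in the sense that $$\|\mu P^n-\nu P^n\|_{\mathrm{BL}}\to 0\quad\text{as }n\to\infty\text{ for every }\mu,\nu\in\mathcal{P}(E).$$
   Context: $E$ is a Polish space with Borel $\sigma$-field $\mathcal{E}$ and $d$ is a complete metric for its topology. $P:E\times\mathcal{E}\to[0,1]$ is a transition kernel, $\mathcal{P}(E)$ is the set of Borel probability measures on $E$, and $\mathbf{P}^x$ is the law on path space of the Markov chain $(X_k)_{k\ge 0}$ with transition kernel $P$ and $X_0=x$. $\mathcal{C}(\mathbf{P}_1,\mathbf{P}_2)$ is the set of couplings of the path-space probabilities $\mathbf{P}_1,\mathbf{P}_2$: probability measures $\mathbf{Q}$ on the product of path space with itself whose first and second marginals are $\mathbf{P}_1$ and $\mathbf{P}_2$; $(X_n,X_n')_{n\ge 0}$ denotes the coordinate process on this product. $\mathrm{Lip}(E)$ is the class of functions $f:E\to\mathbb{R}$ with $\|f\|_\infty\le 1$ and $|f(x)-f(y)|\le d(x,y)$ for all $x,y\in E$. For a finite signed measure $\varrho$ on $E$, $\|\varrho\|_{\mathrm{BL}}=\sup_{f\in\mathrm{Lip}(E)}|\int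 f\,d\varrho|$. *)

theory Defs
  imports "HOL-Probability.Probability"
begin

text \<open>
  The Polish space is the type \<open>'a::polish_space\<close>, whose \<^const>\<open>dist\<close> is a complete metric
  for its topology. A transition kernel is a measurable map from \<^term>\<open>borel\<close> to
  \<^term>\<open>prob_algebra borel\<close>, and path space is \<open>nat \<Rightarrow> 'a\<close> with the product \<open>\<sigma>\<close>-algebra.
\<close>

abbreviation path_space :: "(nat \<Rightarrow> 'a::polish_space) measure" where
  "path_space \<equiv> PiM UNIV (\<lambda>_. borel)"

text \<open>
  Conditional law of the coordinate \<open>X\<^sub>n\<close> given the coordinates \<open>X\<^sub>0, \<dots>, X\<^bsub>n-1\<^esub>\<close> of \<open>\<omega>\<close>.
\<close>

definition chain_step ::
  "('a::polish_space \<Rightarrow> 'a measure) \<Rightarrow> 'a \<Rightarrow> nat \<Rightarrow> (nat \<Rightarrow> 'a) \<Rightarrow> 'a measure" where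
  "chain_step K x n \<omega> = (case n of 0 \<Rightarrow> return borel x | Suc m \<Rightarrow> K (\<omega> m))"

text \<open>
  The law \<open>\<^bold>P\<^sup>x\<close> of the chain with kernel \<open>K\<close> started at \<open>x\<close>: the Ionescu-Tulcea projective limit
  of the one-step laws above. The lemmas \<open>chain_law_start\<close> and \<open>chain_law_Markov\<close> below
  give its defining properties.
\<close>

definition chain_law ::
  "('a::polish_space \<Rightarrow> 'a measure) \<Rightarrow> 'a \<Rightarrow> (nat \<Rightarrow> 'a) measure" where
  "chain_law K x =
     projective_family.lim UNIV (Ionescu_Tulcea.CI (chain_step K x) (\<lambda>_. borel)) (\<lambda>_. borel)"

definition couplings :: "'b measure \<Rightarrow> 'c measure \<Rightarrow> ('b \<times> 'c) measure set" where
  "couplings M N = {Q \<in> space (prob_algebra (M \<Otimes>\<^sub>M N)). distr Q M fst = M \<and> distr Q N snd = N}"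

text \<open>The measure \<open>\<mu>P\<^sup>n\<close>, where \<open>\<rho>P = \<integral> \<rho>(dx) P(x, \<cdot>)\<close>.\<close>

definition kernel_iterate :: "('a \<Rightarrow> 'a measure) \<Rightarrow> nat \<Rightarrow> 'a measure \<Rightarrow> 'a measure" where
  "kernel_iterate K n \<mu> = ((\<lambda>\<rho>. \<rho> \<bind> K) ^^ n) \<mu>"

definition Lip :: "('a::metric_space \<Rightarrow> real) set" where
  "Lip = {f. (\<forall>x. \<bar>f x\<bar> \<le> 1) \<and> (\<forall>x y. \<bar>f x - f y\<bar> \<le> dist x y)}"

text \<open>
  The norm \<open>\<parallel>\<mu> - \<nu>\<parallel>\<^bsub>BL\<^esub>\<close> of the signed measure \<open>\<mu> - \<nu>\<close>, for finite Borel measures \<open>\<mu>\<close>, \<open>\<nu>\<close>; the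
  integral of a bounded measurable function against \<open>\<mu> - \<nu>\<close> is the difference of its integrals.
  The lemma \<open>bdd_above_BL\<close> below shows that for probability measures the real-valued supremum is
  taken over a set that is bounded above.
\<close>

definition BL_norm_diff :: "'a::metric_space measure \<Rightarrow> 'a measure \<Rightarrow> real" where
  "BL_norm_diff \<mu> \<nu> = (SUP f\<in>Lip. \<bar>(\<integral>x. f x \<partial>\<mu>) - (\<integral>x. f x \<partial>\<nu>)\<bar>)"

lemma Ionescu_Tulcea_chain_step:
  assumes "K \<in> borel \<rightarrow>\<^sub>M prob_algebra borel"
  shows "Ionescu_Tulcea (chain_step K x) (\<lambda>_. borel)"
proof (rule Ionescu_Tulcea.intro)
  have K: "K \<in> borel \<rightarrow>\<^sub>M subprob_algebra borel"
    using assms by (rule measurable_prob_algebraD)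
  show "chain_step K x i \<in> PiM {0..<i} (\<lambda>_. borel) \<rightarrow>\<^sub>M subprob_algebra borel" for i
  proof (cases i)
    case 0
    have "return borel x \<in> space (subprob_algebra borel)"
      by (simp add: space_subprob_algebra prob_space_return prob_space_imp_subprob_space)
    then show ?thesis
      unfolding 0 chain_step_def[abs_def] nat.case by (rule measurable_const)
  next
    case (Suc m)
    have "(\<lambda>\<omega>. \<omega> m) \<in> PiM {0..<i} (\<lambda>_. borel) \<rightarrow>\<^sub>M (borel :: 'a measure)"
      by (rule measurable_component_singleton) (simp add: Suc)
    from measurable_compose[OF this K] show ?thesis
      by (simp add: Suc chain_step_def[abs_def])
  qed
  have "prob_space (K y)" for y
    using measurable_space[OF assms, of y] by (simp add: space_prob_algebra)
  then show "prob_space (chain_step K x i \<omega>)" for i \<omega>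
    by (simp add: chain_step_def prob_space_return split: nat.split)
qed

lemma sets_chain_law:
  assumes "K \<in> borel \<rightarrow>\<^sub>M prob_algebra borel"
  shows "sets (chain_law K x) = sets path_space"
proof -
  interpret IT: Ionescu_Tulcea "chain_step K x" "\<lambda>_. borel"
    by (rule Ionescu_Tulcea_chain_step[OF assms])
  show ?thesis
    by (simp add: chain_law_def IT.PF.sets_lim)
qed

lemma distr_chain_law:
  assumes "K \<in> borel \<rightarrow>\<^sub>M prob_algebra borel"
  shows "distr (chain_law K x) (PiM {0..<n} (\<lambda>_. borel)) (\<lambda>\<omega>. restrict \<omega> {0..<n}) =
    Ionescu_Tulcea.C (chain_step K x) (\<lambda>_. borel) 0 n (\<lambda>_. undefined)"
proof -
  interpret IT: Ionescu_Tulcea "chain_step K x" "\<lambda>_. borel"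
    by (rule Ionescu_Tulcea_chain_step[OF assms])
  have "IT.up_to {0..<n} \<le> n"
    by (simp add: IT.up_to_iff)
  moreover have "n \<le> IT.up_to {0..<n}"
    using IT.up_to_less[of "{0..<n}" "n - 1"] by (cases n) auto
  ultimately have "IT.up_to {0..<n} = n"
    by simp
  then have "IT.CI {0..<n} = IT.C 0 n (\<lambda>_. undefined)"
    using IT.distr_C[of n n "\<lambda>_. undefined" 0] by (simp add: IT.CI_def)
  then show ?thesis
    using IT.distr_lim[of "{0..<n}"] by (simp add: chain_law_def)
qed

lemma prob_space_chain_law:
  assumes "K \<in> borel \<rightarrow>\<^sub>M prob_algebra borel"
  shows "prob_space (chain_law K x)"
proof -
  interpret IT: Ionescu_Tulcea "chain_step K x" "\<lambda>_. borel"
    by (rule Ionescu_Tulcea_chain_step[OF assms])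
  have "prob_space (IT.C 0 0 (\<lambda>_. undefined))"
    by (rule IT.prob_space_C) simp
  then have "prob_space (distr (chain_law K x) (PiM {0..<0} (\<lambda>_. borel)) (\<lambda>\<omega>. restrict \<omega> {0..<0}))"
    by (simp only: distr_chain_law[OF assms])
  then show ?thesis
    by (rule prob_space_distrD[rotated])
      (auto intro!: measurable_restrict
        simp: measurable_cong_sets[OF sets_chain_law[OF assms] refl])
qed

text \<open>
  For every time \<open>n\<close>, the law of \<open>(X\<^sub>0, \<dots>, X\<^sub>n)\<close> is obtained from that of \<open>(X\<^sub>0, \<dots>, X\<^bsub>n-1\<^esub>)\<close> by
  sampling \<open>X\<^sub>n\<close> from \<open>chain_step K x n\<close>.
\<close>

lemma distr_chain_law_Suc:
  assumes "K \<in> borel \<rightarrow>\<^sub>M prob_algebra borel"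
  shows "distr (chain_law K x) (PiM {0..<Suc n} (\<lambda>_. borel)) (\<lambda>\<omega>. restrict \<omega> {0..<Suc n}) =
    distr (chain_law K x) (PiM {0..<n} (\<lambda>_. borel)) (\<lambda>\<omega>. restrict \<omega> {0..<n}) \<bind>
      (\<lambda>\<omega>. distr (chain_step K x n \<omega>) (PiM {0..<Suc n} (\<lambda>_. borel)) (fun_upd \<omega> n))"
proof -
  interpret IT: Ionescu_Tulcea "chain_step K x" "\<lambda>_. borel"
    by (rule Ionescu_Tulcea_chain_step[OF assms])
  show ?thesis
    by (simp add: distr_chain_law[OF assms] IT.eP_def[abs_def])
qed

lemma emeasure_chain_law_step:
  fixes K :: "'a::polish_space \<Rightarrow> 'a measure"
  assumes K: "K \<in> borel \<rightarrow>\<^sub>M prob_algebra borel"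
    and A[measurable]: "A \<in> sets (PiM {0..<n} (\<lambda>_. borel))" and B[measurable]: "B \<in> sets borel"
  shows "emeasure (chain_law K x) {\<omega>. restrict \<omega> {0..<n} \<in> A \<and> \<omega> n \<in> B} =
    (\<integral>\<^sup>+\<omega>. indicator A (restrict \<omega> {0..<n}) *
       emeasure (chain_step K x n (restrict \<omega> {0..<n})) B \<partial>chain_law K x)"
proof -
  let ?P = "\<lambda>n. PiM {0..<n} (\<lambda>_. borel :: 'a measure)"
  interpret IT: Ionescu_Tulcea "chain_step K x" "\<lambda>_. borel"
    by (rule Ionescu_Tulcea_chain_step[OF K])
  let ?D = "\<lambda>n. distr (chain_law K x) (?P n) (\<lambda>\<omega>. restrict \<omega> {0..<n})"
  note [measurable_cong] = sets_chain_law[OF K]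
  have space: "space (chain_law K x) = UNIV"
    using sets_eq_imp_space_eq[OF sets_chain_law[OF K]] by (auto simp: space_PiM)
  have r[measurable]: "(\<lambda>\<omega>. restrict \<omega> {0..<m}) \<in> chain_law K x \<rightarrow>\<^sub>M ?P m" for m
    by (auto intro!: measurable_restrict simp: measurable_cong_sets[OF sets_chain_law[OF K] refl])
  define S where "S = {\<omega> \<in> space (?P (Suc n)). restrict \<omega> {0..<n} \<in> A \<and> \<omega> n \<in> B}"
  have r2[measurable]: "(\<lambda>\<omega>. restrict \<omega> {0..<n}) \<in> ?P (Suc n) \<rightarrow>\<^sub>M ?P n"
    by (intro measurable_restrict_subset) auto
  have r3[measurable]: "(\<lambda>\<omega>. \<omega> n) \<in> ?P (Suc n) \<rightarrow>\<^sub>M borel"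
    by (rule measurable_component_singleton) simp
  have S[measurable]: "S \<in> sets (?P (Suc n))"
    unfolding S_def by measurable
  have step: "emeasure (IT.eP n \<omega>) S = indicator A \<omega> * emeasure (chain_step K x n \<omega>) B"
    if "\<omega> \<in> space (?P n)" for \<omega>
  proof -
    have ext: "restrict \<omega> {0..<n} = \<omega>"
      using that by (auto simp: space_PiM PiE_iff restrict_def extensional_def)
    have "restrict (fun_upd \<omega> n y) {0..<n} = \<omega>" for y
      by (subst (2) ext[symmetric]) (auto simp: restrict_def)
    moreover have "fun_upd \<omega> n y \<in> space (?P (Suc n))" for y
      using that by (auto simp: space_PiM PiE_iff extensional_def)
    ultimately have "fun_upd \<omega> n -` S = (if \<omega> \<in> A then B else {})"
      by (auto simp: S_def)
    then show ?thesis
      using IT.emeasure_eP[OF that S] by (auto simp: indicator_def)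
  qed
  have "emeasure (chain_law K x) {\<omega>. restrict \<omega> {0..<n} \<in> A \<and> \<omega> n \<in> B} = emeasure (?D (Suc n)) S"
    by (subst emeasure_distr[OF r S], rule arg_cong[where f = "emeasure (chain_law K x)"])
      (auto simp: S_def space space_PiM Int_absorb1)
  also have "\<dots> = (\<integral>\<^sup>+\<omega>. emeasure (IT.eP n \<omega>) S \<partial>?D n)"
    unfolding distr_chain_law_Suc[OF K] IT.eP_def[symmetric]
    by (rule emeasure_bind[where N = "?P (Suc n)"])
      (use IT.measurable_eP[of n] S in \<open>auto simp: space_PiM\<close>)
  also have "\<dots> = (\<integral>\<^sup>+\<omega>. indicator A \<omega> * emeasure (chain_step K x n \<omega>) B \<partial>?D n)"
    by (intro nn_integral_cong step) simp
  also have "\<dots> = (\<integral>\<^sup>+\<omega>. indicator A (restrict \<omega> {0..<n}) *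
       emeasure (chain_step K x n (restrict \<omega> {0..<n})) B \<partial>chain_law K x)"
    using IT.P[of n] by (intro nn_integral_distr r) simp
  finally show ?thesis .
qed

lemma chain_law_start:
  fixes K :: "'a::polish_space \<Rightarrow> 'a measure"
  assumes K: "K \<in> borel \<rightarrow>\<^sub>M prob_algebra borel" and B: "B \<in> sets borel"
  shows "emeasure (chain_law K x) {\<omega>. \<omega> 0 \<in> B} = indicator B x"
proof -
  interpret prob_space "chain_law K x"
    by (rule prob_space_chain_law[OF K])
  have "{\<lambda>_. undefined} \<in> sets (PiM {0..<0::nat} (\<lambda>_. borel :: 'a measure))"
    by (simp add: PiM_empty)
  from emeasure_chain_law_step[OF K this B] show ?thesis
    using B emeasure_space_1 by (simp add: restrict_def chain_step_def)
qed

lemma chain_law_Markov: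
  fixes K :: "'a::polish_space \<Rightarrow> 'a measure"
  assumes K: "K \<in> borel \<rightarrow>\<^sub>M prob_algebra borel"
    and A: "A \<in> sets (PiM {0..<Suc n} (\<lambda>_. borel))" and B: "B \<in> sets borel"
  shows "emeasure (chain_law K x) {\<omega>. restrict \<omega> {0..<Suc n} \<in> A \<and> \<omega> (Suc n) \<in> B} =
    (\<integral>\<^sup>+\<omega>. indicator A (restrict \<omega> {0..<Suc n}) * emeasure (K (\<omega> n)) B \<partial>chain_law K x)"
  using emeasure_chain_law_step[OF K A B, of x] by (simp add: chain_step_def)

lemma bdd_above_BL:
  fixes \<mu> \<nu> :: "'a::polish_space measure"
  assumes "\<mu> \<in> space (prob_algebra borel)" "\<nu> \<in> space (prob_algebra borel)"
  shows "bdd_above ((\<lambda>f. \<bar>(\<integral>x. f x \<partial>\<mu>) - (\<integral>x. f x \<partial>\<nu>)\<bar>) ` Lip)"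
proof -
  have bound: "\<bar>\<integral>x. f x \<partial>\<rho>\<bar> \<le> 1" if "\<rho> \<in> space (prob_algebra borel)" "f \<in> Lip"
    for \<rho> :: "'a measure" and f
  proof -
    interpret prob_space \<rho>
      using that(1) by (simp add: space_prob_algebra)
    have "\<bar>\<integral>x. f x \<partial>\<rho>\<bar> \<le> (\<integral>x. \<bar>f x\<bar> \<partial>\<rho>)"
      by (rule integral_abs_bound)
    also have "\<dots> \<le> (\<integral>x. 1 \<partial>\<rho>)"
      using that(2) by (intro integral_mono') (auto simp: Lip_def)
    finally show ?thesis
      by (simp add: prob_space)
  qed
  show ?thesis
    using bound[OF assms(1)] bound[OF assms(2)] by (intro bdd_aboveI2[where M = 2]) fastforce
qed

end

theory Submission
  imports Defs
begin

text \<open>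
  By definition of the supremum it suffices to fix functions \<open>f\<^sub>n \<in> Lip\<close> that
  nearly attain the norms at the times \<open>n\<close> and to show that the integrals of
  \<open>f\<^sub>n\<close> against \<open>\<mu>P\<^sup>n\<close> and \<open>\<nu>P\<^sup>n\<close> have a
  difference that tends to \<open>0\<close>. The difficulty is that a coupling only brings the two paths
  close, without making them meet, so events that depend on the exact path need not be comparable. The
  cure is to look at the chain through noise: given the path, toss independent coins
  \<open>Y\<^sub>n\<close> that show heads with probability \<open>1/2 + f\<^sub>n(X\<^sub>n)/4\<close>.
  The integral in question is recovered from the probability of heads at time \<open>n\<close>, so the
  goal is that the laws of \<open>Y\<^sub>n\<close> under the two initial measures merge.

  The noise turns closeness into overlap. The coins of two paths have success probabilities in
  \<open>[1/4, 3/4]\<close> which differ by at most \<open>d(X\<^sub>n, X\<^sub>n')/4\<close>; the Hellinger affinity of two such coins is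
  \<open>1 - O(d(X\<^sub>n, X\<^sub>n')\<^sup>2)\<close>. Where the sum of the squared distances is finite, its tail is small, and
  hence the laws of the whole sequence of late coins overlap by a fixed amount. Averaging over a
  coupling, the laws of the late coins under any two starting points overlap by at least \<open>\<alpha>/8\<close>,
  no matter how many coins are observed (\<open>coupling_overlap\<close>).

  This overlap makes the coins mixing (\<open>mixing_word_prob\<close>): a function of coins that are tossed far in
  the future cannot follow a function \<open>\<phi>\<close> of early coins in mean square, unless the variance of \<open>\<phi>\<close>
  is small. Indeed, whatever two different values \<open>\<phi>\<close> has taken, part of the law of the late coins is
  common to both situations, and there any late function is wrong about one of the two values.

  Now let the initial measure be \<open>\<mu>\<close> or \<open>\<nu>\<close> according to a fair sign \<open>\<theta>\<close>, and let \<open>\<delta>\<^sub>n\<close> be the least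
  mean square error of a prediction of \<open>\<theta>\<close> from finitely many coins tossed from time \<open>n\<close> on. The
  sequence \<open>\<delta>\<^sub>n\<close> increases to some \<open>D \<le> 1\<close>. A nearly optimal predictor from time \<open>n\<close> and a nearly
  optimal predictor from a much later time both have error close to \<open>D\<close>, while their midpoint has
  error at least \<open>\<delta>\<^sub>n\<close>, also close to \<open>D\<close>. By the parallelogram law the two predictors are close, by
  mixing the early one is almost constant, and a constant predicts \<open>\<theta>\<close> with error at least \<open>1\<close>.
  Hence \<open>D = 1\<close>: late coins carry no information about \<open>\<theta>\<close>
  (\<open>mixing_imp_indistinguishable\<close>). In particular the law of the single coin \<open>Y\<^sub>n\<close> forgets \<open>\<theta>\<close>.

  Only finitely many coins matter at a time, so the coins are represented by the probabilities of
  finite words, and all conditioning is on finite words.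
\<close>

section \<open>Laws of finite words\<close>

definition words :: "nat \<Rightarrow> bool list set" where
  "words l = {xs. length xs = l}"

lemma finite_words [simp]: "finite (words l)"
  using finite_lists_length_eq[of "UNIV :: bool set" l] by (simp add: words_def)

lemma words_0: "words 0 = {[]}"
  by (auto simp: words_def)

lemma sum_words_add:
  "(\<Sum>xs\<in>words (a + b). f xs) = (\<Sum>ws\<in>words a. \<Sum>zs\<in>words b. f (ws @ zs))"
proof -
  have "(\<Sum>ws\<in>words a. \<Sum>zs\<in>words b. f (ws @ zs)) =
      (\<Sum>(ws, zs)\<in>words a \<times> words b. f (ws @ zs))"
    by (simp add: sum.cartesian_product)
  also have "\<dots> = (\<Sum>xs\<in>words (a + b). f xs)"
    by (rule sum.reindex_bij_witness[where i = "\<lambda>xs. (take a xs, drop a xs)"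
          and j = "\<lambda>(ws, zs). ws @ zs"]) (auto simp: words_def)
  finally show ?thesis ..
qed

lemma sum_words_Suc:
  "(\<Sum>xs\<in>words (Suc l). f xs) = (\<Sum>b\<in>UNIV. \<Sum>xs\<in>words l. f (b # xs))"
proof -
  have "words 1 = range (\<lambda>b. [b])"
    by (auto simp: words_def length_Suc_conv)
  then show ?thesis
    using sum_words_add[of f 1 l] by (simp add: sum.reindex inj_on_def)
qed

text \<open>
  The number \<open>q n xs\<close> stands for the probability that the tosses at the times
  \<open>n, n + 1, \<dots>\<close> spell the word \<open>xs\<close>, in one random sequence of tosses; the last two clauses say that
  a block of tosses may be left out at the end and at the beginning.
\<close>
definition consistent :: "(nat \<Rightarrow> bool list \<Rightarrow> real) \<Rightarrow> bool" where
  "consistent q \<longleftrightarrow> (\<forall>n xs. 0 \<le> q n xs) \<and> (\<forall>n. q n [] = 1) \<and>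
    (\<forall>n d xs. (\<Sum>us\<in>words d. q n (xs @ us)) = q n xs) \<and>
    (\<forall>n d xs. (\<Sum>us\<in>words d. q n (us @ xs)) = q (n + d) xs)"

definition word_avg :: "(nat \<Rightarrow> bool list \<Rightarrow> real) \<Rightarrow> nat \<Rightarrow> nat \<Rightarrow> (bool list \<Rightarrow> real) \<Rightarrow> real" where
  "word_avg q n l F = (\<Sum>xs\<in>words l. q n xs * F xs)"

lemma word_avg_add: "word_avg q n l (\<lambda>xs. F xs + G xs) = word_avg q n l F + word_avg q n l G"
  by (simp add: word_avg_def sum.distrib algebra_simps)

lemma word_avg_diff: "word_avg q n l (\<lambda>xs. F xs - G xs) = word_avg q n l F - word_avg q n l G"
  by (simp add: word_avg_def sum_subtractf algebra_simps)

lemma word_avg_cmult: "word_avg q n l (\<lambda>xs. a * F xs) = a * word_avg q n l F"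
  by (simp add: word_avg_def sum_distrib_left algebra_simps)

lemma word_avg_family_mean:
  "word_avg (\<lambda>n xs. (p n xs + q n xs) / 2) n l F = (word_avg p n l F + word_avg q n l F) / 2"
proof -
  have "word_avg (\<lambda>n xs. (p n xs + q n xs) / 2) n l F =
      (\<Sum>xs\<in>words l. (p n xs * F xs + q n xs * F xs) / 2)"
    unfolding word_avg_def by (intro sum.cong refl) (simp add: field_simps)
  then show ?thesis
    by (simp add: word_avg_def sum_divide_distrib[symmetric] sum.distrib)
qed

lemma word_avg_const:
  assumes "consistent q"
  shows "word_avg q n l (\<lambda>_. a) = a"
proof -
  have "(\<Sum>us\<in>words l. q n ([] @ us)) = 1"
    using assms unfolding consistent_def by (simp only:)
  then show ?thesis
    by (simp add: word_avg_def sum_distrib_right[symmetric])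
qed

lemma word_avg_mono:
  "consistent q \<Longrightarrow> (\<And>xs. F xs \<le> G xs) \<Longrightarrow> word_avg q n l F \<le> word_avg q n l G"
  unfolding word_avg_def consistent_def by (intro sum_mono mult_left_mono) auto

lemma word_avg_take:
  assumes "consistent q"
  shows "word_avg q n (a + b) (\<lambda>xs. F (take a xs)) = word_avg q n a F"
proof -
  have "word_avg q n (a + b) (\<lambda>xs. F (take a xs)) =
      (\<Sum>ws\<in>words a. \<Sum>zs\<in>words b. q n (ws @ zs) * F ws)"
    unfolding word_avg_def sum_words_add by (intro sum.cong refl) (auto simp: words_def)
  then show ?thesis
    using assms by (simp add: word_avg_def consistent_def sum_distrib_right[symmetric])
qed

lemma word_avg_drop:
  assumes "consistent q"
  shows "word_avg q n (a + b) (\<lambda>xs. F (drop a xs)) = word_avg q (n + a) b F"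
proof -
  have "word_avg q n (a + b) (\<lambda>xs. F (drop a xs)) =
      (\<Sum>ws\<in>words a. \<Sum>zs\<in>words b. q n (ws @ zs) * F zs)"
    unfolding word_avg_def sum_words_add by (intro sum.cong refl) (auto simp: words_def)
  also have "\<dots> = (\<Sum>zs\<in>words b. \<Sum>ws\<in>words a. q n (ws @ zs) * F zs)"
    by (rule sum.swap)
  finally show ?thesis
    using assms by (simp add: word_avg_def consistent_def sum_distrib_right[symmetric])
qed

text \<open>
  Here \<open>F\<close> is a function of \<open>l\<close> tosses that start at time \<open>n\<close>, and \<open>F' d\<close> is a function of \<open>l' d\<close>
  tosses that start after a gap of \<open>d\<close> further tosses. Both the form and the length of \<open>F' d\<close>
  may change with the gap.
\<close>
definition mixing :: "real \<Rightarrow> (nat \<Rightarrow> bool list \<Rightarrow> real) \<Rightarrow> bool" where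
  "mixing c r \<longleftrightarrow> (\<forall>n l F l' F' \<epsilon>. 0 < \<epsilon> \<longrightarrow> (\<forall>\<^sub>F d in sequentially.
     c * word_avg r n l (\<lambda>xs. (F xs - word_avg r n l F)\<^sup>2) - \<epsilon>
       \<le> word_avg r n (l + d + l' d) (\<lambda>xs. (F (take l xs) - F' d (drop (l + d) xs))\<^sup>2)))"

section \<open>Mixing erases the initial law\<close>

text \<open>
  Under the mean of \<open>p\<close> and \<open>q\<close>, a sign \<open>\<theta> = \<plusminus>1\<close> chooses between the two laws. The sequence \<open>\<delta>\<close>
  measures how well \<open>\<theta>\<close> can be predicted in mean square from late tosses. The midpoint of two nearly
  optimal predictors, one early and one late, is again nearly optimal, so they are close to each
  other; mixing then makes the early one almost constant, and \<open>\<delta>\<close> tends to the variance of \<open>\<theta>\<close>.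
\<close>
lemma mixing_imp_indistinguishable:
  fixes p q :: "nat \<Rightarrow> bool list \<Rightarrow> real"
  assumes p: "consistent p" and q: "consistent q"
    and c: "0 < c" and mix: "mixing c (\<lambda>n xs. (p n xs + q n xs) / 2)"
  shows "(\<lambda>n. p n [True] - q n [True]) \<longlonglongrightarrow> 0"
proof -
  define r where "r = (\<lambda>n xs. (p n xs + q n xs) / 2)"
  have r_avg: "word_avg r n l F = (word_avg p n l F + word_avg q n l F) / 2" for n l F
    unfolding r_def by (rule word_avg_family_mean)
  define err where "err n l F =
    (word_avg p n l (\<lambda>xs. (1 - F xs)\<^sup>2) + word_avg q n l (\<lambda>xs. (- 1 - F xs)\<^sup>2)) / 2" for n l F
  define \<delta> where "\<delta> n = (INF (l, F)\<in>UNIV. err n l F)" for n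
  have err_nonneg: "0 \<le> err n l F" for n l F
    using p q unfolding err_def word_avg_def consistent_def
    by (intro divide_nonneg_nonneg add_nonneg_nonneg sum_nonneg mult_nonneg_nonneg) auto
  have bdd: "bdd_below (range (\<lambda>(l, F). err n l F))" for n
    by (rule bdd_belowI2[where m = 0]) (auto simp: err_nonneg)
  have \<delta>_le: "\<delta> n \<le> err n l F" for n l F
    using cINF_lower[OF bdd UNIV_I, of n "(l, F)"] by (simp add: \<delta>_def)
  have err_take: "err n (a + b) (\<lambda>xs. F (take a xs)) = err n a F" for n a b F
    unfolding err_def
    using word_avg_take[OF p, of n a b "\<lambda>xs. (1 - F xs)\<^sup>2"]
      word_avg_take[OF q, of n a b "\<lambda>xs. (- 1 - F xs)\<^sup>2"] by simp
  have err_drop: "err n (a + b) (\<lambda>xs. F (drop a xs)) = err (n + a) b F" for n a b F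
    unfolding err_def
    using word_avg_drop[OF p, of n a b "\<lambda>xs. (1 - F xs)\<^sup>2"]
      word_avg_drop[OF q, of n a b "\<lambda>xs. (- 1 - F xs)\<^sup>2"] by simp
  \<comment> \<open>A predictor from time \<open>n + 1\<close> on is a predictor from time \<open>n\<close> on that ignores one toss.\<close>
  have "\<delta> n \<le> \<delta> (Suc n)" for n
  proof -
    have "\<delta> n \<le> err (Suc n) l F" for l F
      using \<delta>_le[of n "1 + l" "\<lambda>xs. F (drop 1 xs)"] err_drop[of n 1 l F] by simp
    then show ?thesis
      unfolding \<delta>_def[of "Suc n"] by (intro cINF_greatest) auto
  qed
  then have inc: "incseq \<delta>"
    by (rule incseq_SucI)
  have \<delta>_le_1: "\<delta> n \<le> 1" for n
    using \<delta>_le[of n 0 "\<lambda>_. 0"] by (simp add: err_def word_avg_const[OF p] word_avg_const[OF q])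
  obtain D where D: "\<delta> \<longlonglongrightarrow> D" and \<delta>_le_D: "\<And>n. \<delta> n \<le> D"
    using incseq_convergent[OF inc] \<delta>_le_1 by metis
  have near: "\<exists>l F. err n l F < D + \<epsilon>" if "0 < \<epsilon>" for n \<epsilon>
  proof -
    have "\<delta> n < D + \<epsilon>"
      using \<delta>_le_D[of n] that by linarith
    then show ?thesis
      using cINF_less_iff[OF _ bdd, of n "D + \<epsilon>"] by (auto simp: \<delta>_def)
  qed
  have D_bound: "1 - t\<^sup>2 - t - 9 * t / c \<le> D" if t: "0 < t" for t
  proof -
    \<comment> \<open>The variance of the early predictor will be at most \<open>9 \<epsilon> / c\<close>; dividing it by \<open>t\<close> below must
      still leave a small quantity.\<close>
    define \<epsilon> where "\<epsilon> = t\<^sup>2"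
    have \<epsilon>: "0 < \<epsilon>"
      using t by (simp add: \<epsilon>_def)
    from order_tendstoD(1)[OF D, of "D - \<epsilon>"] \<epsilon> obtain n where n: "D - \<epsilon> < \<delta> n"
      by (auto simp: eventually_sequentially)
    obtain l F where F: "err n l F < D + \<epsilon>"
      using near[OF \<epsilon>] by blast
    have "\<forall>d. \<exists>l' F'. err (n + (l + d)) l' F' < D + \<epsilon>"
      using near[OF \<epsilon>] by blast
    then obtain l' F' where F': "\<And>d. err (n + (l + d)) (l' d) (F' d) < D + \<epsilon>"
      by metis
    define V where "V = word_avg r n l (\<lambda>xs. (F xs - word_avg r n l F)\<^sup>2)"
    have "\<forall>\<^sub>F d in sequentially. c * V - \<epsilon>
        \<le> word_avg r n (l + d + l' d) (\<lambda>xs. (F (take l xs) - F' d (drop (l + d) xs))\<^sup>2)"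
      using mix \<epsilon> unfolding mixing_def r_def[symmetric] V_def by blast
    then obtain d where d: "c * V - \<epsilon>
        \<le> word_avg r n (l + d + l' d) (\<lambda>xs. (F (take l xs) - F' d (drop (l + d) xs))\<^sup>2)"
      by (auto simp: eventually_sequentially)
    define L where "L = l + d + l' d"
    define \<phi> \<phi>' where "\<phi> xs = F (take l xs)" and "\<phi>' xs = F' d (drop (l + d) xs)" for xs
    have e1: "err n L \<phi> = err n l F"
      using err_take[of n l "d + l' d" F] by (simp add: L_def \<phi>_def[abs_def] add.assoc)
    have e2: "err n L \<phi>' = err (n + (l + d)) (l' d) (F' d)"
      using err_drop[of n "l + d" "l' d" "F' d"] by (simp add: L_def \<phi>'_def[abs_def])
    \<comment> \<open>The parallelogram law, applied with \<open>\<theta> = 1\<close> and \<open>\<theta> = - 1\<close>.\<close>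
    have mid: "(\<theta> - (x + y) / 2)\<^sup>2 = (1/2) * (\<theta> - x)\<^sup>2 + (1/2) * (\<theta> - y)\<^sup>2 - (1/4) * (x - y)\<^sup>2"
      for \<theta> x y :: real
      by (simp add: power2_eq_square field_simps)
    have "err n L (\<lambda>xs. (\<phi> xs + \<phi>' xs) / 2) = err n L \<phi> / 2 + err n L \<phi>' / 2
        - word_avg r n L (\<lambda>xs. (\<phi> xs - \<phi>' xs)\<^sup>2) / 4"
      unfolding err_def mid word_avg_add word_avg_diff word_avg_cmult r_avg
      by (simp add: field_simps)
    with \<delta>_le[of n L "\<lambda>xs. (\<phi> xs + \<phi>' xs) / 2"] n F F'[of d] e1 e2
    have "word_avg r n L (\<lambda>xs. (\<phi> xs - \<phi>' xs)\<^sup>2) < 8 * \<epsilon>"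
      by simp
    with d have "c * V < 9 * \<epsilon>"
      by (simp add: L_def \<phi>_def \<phi>'_def)
    then have V: "V < 9 * \<epsilon> / c"
      using c by (simp add: field_simps)
    define a where "a = word_avg r n l F"
    define w where "w = 1 / t"
    \<comment> \<open>Expand the square and bound the correlation of \<open>\<theta>\<close> with the deviation \<open>x - a\<close> by weighted AM-GM;
      the term \<open>2 \<theta> a\<close> cancels in the mean over the two signs.\<close>
    have lower: "1 - 2 * \<theta> * a - t - w * (x - a)\<^sup>2 \<le> (\<theta> - x)\<^sup>2"
      if "\<theta> = 1 \<or> \<theta> = - 1" for \<theta> x
    proof -
      have "0 \<le> (t - \<theta> * (x - a))\<^sup>2 / t"
        using t by simp
      also have "\<dots> = t - 2 * \<theta> * (x - a) + \<theta>\<^sup>2 * w * (x - a)\<^sup>2"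
        using t by (simp add: w_def power2_eq_square field_simps)
      finally have "2 * \<theta> * (x - a) \<le> t + w * (x - a)\<^sup>2"
        using that by auto
      moreover have "(\<theta> - x)\<^sup>2 = 1 - 2 * \<theta> * (x - a) - 2 * \<theta> * a + x\<^sup>2"
        using that by (auto simp: power2_eq_square algebra_simps)
      ultimately show ?thesis
        by (smt (verit) zero_le_power2)
    qed
    have "1 - 2 * a - t - w * word_avg p n l (\<lambda>xs. (F xs - a)\<^sup>2)
        \<le> word_avg p n l (\<lambda>xs. (1 - F xs)\<^sup>2)"
      using word_avg_mono[OF p, of "\<lambda>xs. (1 - 2 * 1 * a - t) - w * (F xs - a)\<^sup>2"
          "\<lambda>xs. (1 - F xs)\<^sup>2" n l] lower[of 1]
      unfolding word_avg_diff word_avg_cmult word_avg_const[OF p] by simp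
    moreover have "1 + 2 * a - t - w * word_avg q n l (\<lambda>xs. (F xs - a)\<^sup>2)
        \<le> word_avg q n l (\<lambda>xs. (- 1 - F xs)\<^sup>2)"
      using word_avg_mono[OF q, of "\<lambda>xs. (1 - 2 * (- 1) * a - t) - w * (F xs - a)\<^sup>2"
          "\<lambda>xs. (- 1 - F xs)\<^sup>2" n l] lower[of "- 1"]
      unfolding word_avg_diff word_avg_cmult word_avg_const[OF q] by simp
    moreover have "w * V = (w * word_avg p n l (\<lambda>xs. (F xs - a)\<^sup>2)
        + w * word_avg q n l (\<lambda>xs. (F xs - a)\<^sup>2)) / 2"
      unfolding V_def a_def[symmetric] r_avg[of n l "\<lambda>xs. (F xs - a)\<^sup>2"]
      by (simp add: algebra_simps add_divide_distrib)
    ultimately have "1 - t - w * V \<le> err n l F"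
      unfolding err_def by (simp add: field_simps)
    moreover have "w * V \<le> w * (9 * \<epsilon> / c)"
      using V t by (intro mult_left_mono) (auto simp: w_def)
    moreover have "w * (9 * \<epsilon> / c) = 9 * t / c"
      using t by (simp add: w_def \<epsilon>_def power2_eq_square)
    ultimately show ?thesis
      using F unfolding \<epsilon>_def by linarith
  qed
  have "((\<lambda>t. 1 - t\<^sup>2 - t - 9 * t / c) \<longlongrightarrow> 1 - 0\<^sup>2 - 0 - 9 * 0 / c) (at_right 0)"
    using c by (intro tendsto_intros) auto
  then have "1 - 0\<^sup>2 - 0 - 9 * 0 / c \<le> D"
  proof (rule tendsto_upperbound)
    show "\<forall>\<^sub>F t in at_right 0. 1 - t\<^sup>2 - t - 9 * t / c \<le> D"
      using eventually_at_right_less[of "0::real"] by eventually_elim (rule D_bound)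
  qed simp
  then have D1: "1 \<le> D"
    by simp
  \<comment> \<open>The single toss at time \<open>n\<close>, read as \<open>\<plusminus>t\<close>, is a predictor with error
    \<open>1 - 2 t (p n [True] - q n [True]) + t\<^sup>2\<close>, and no predictor does better than \<open>\<delta> n\<close>.\<close>
  have sq: "\<bar>p n [True] - q n [True]\<bar> \<le> t" if t: "0 < t" and n: "1 - t\<^sup>2 < \<delta> n" for n t
  proof -
    have two: "word_avg u n 1 G = u n [True] * G [True] + (1 - u n [True]) * G [False]"
      if "consistent u" for u G
    proof -
      have "words 1 = {[True], [False]}"
        by (auto simp: words_def length_Suc_conv)
      then have "word_avg u n 1 H = u n [True] * H [True] + u n [False] * H [False]" for H
        by (simp add: word_avg_def)
      from this[of G] this[of "\<lambda>_. 1"] word_avg_const[OF that, of n 1 1] show ?thesis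
        by simp
    qed
    have "\<delta> n \<le> 1 - 2 * s * (p n [True] - q n [True]) + s\<^sup>2" for s
      using \<delta>_le[of n 1 "\<lambda>xs. if hd xs then s else - s"] unfolding err_def two[OF p] two[OF q]
      by (simp add: power2_eq_square algebra_simps)
    from this[of t] this[of "- t"] n
    have "t * (p n [True] - q n [True]) \<le> t * t" "t * (q n [True] - p n [True]) \<le> t * t"
      unfolding power2_eq_square right_diff_distrib by linarith+
    then have "p n [True] - q n [True] \<le> t" "q n [True] - p n [True] \<le> t"
      using t by (simp_all only: mult_le_cancel_left_pos)
    then show ?thesis
      by linarith
  qed
  show ?thesis
  proof (rule LIMSEQ_I)
    fix e :: real assume e: "0 < e"
    then have "0 < (e/2)\<^sup>2"
      by simp
    then have "1 - (e/2)\<^sup>2 < D"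
      using D1 by linarith
    from order_tendstoD(1)[OF D this] obtain N where N: "\<forall>n\<ge>N. 1 - (e/2)\<^sup>2 < \<delta> n"
      by (auto simp: eventually_sequentially)
    then show "\<exists>N. \<forall>n\<ge>N. norm (p n [True] - q n [True] - 0) < e"
    proof (intro exI[of _ N] allI impI)
      fix n assume "N \<le> n"
      with N sq[of "e/2" n] e show "norm (p n [True] - q n [True] - 0) < e"
        by simp
    qed
  qed
qed

section \<open>Coins tossed along the chain\<close>
definition unit_fun :: "('a::topological_space \<Rightarrow> real) \<Rightarrow> bool" where
  "unit_fun g \<longleftrightarrow> g \<in> borel_measurable borel \<and> (\<forall>x. 0 \<le> g x \<and> g x \<le> 1)"

lemma unit_funD:
  assumes "unit_fun g"
  shows "g \<in> borel_measurable borel" "0 \<le> g x" "g x \<le> 1"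
  using assms by (auto simp: unit_fun_def)

lemma unit_fun_one [simp]: "unit_fun (\<lambda>_. 1)"
  by (simp add: unit_fun_def)

lemma unit_fun_mult:
  "unit_fun f \<Longrightarrow> unit_fun g \<Longrightarrow> unit_fun (\<lambda>x. f x * g x)"
  by (auto simp: unit_fun_def mult_le_one)

lemma integrable_unit_fun:
  fixes M :: "'a::topological_space measure"
  assumes "finite_measure M" "sets M = sets borel" "unit_fun f"
  shows "integrable M f"
proof -
  interpret finite_measure M by fact
  have "f \<in> borel_measurable M"
    using assms(3) unfolding unit_fun_def measurable_cong_sets[OF assms(2) refl] by simp
  then show ?thesis
    using assms(3) by (intro integrable_const_bound[where B = 1]) (auto simp: unit_fun_def)
qed

text \<open>
  The expectation of \<open>g\<^sub>0(X\<^sub>0) \<cdots> g\<^sub>k(X\<^sub>k)\<close> for the chain started at \<open>x\<close>, computed by conditioning on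
  the first step; that it is this integral over path space is shown in \<open>integral_chain_law_prod\<close>.
  A constant factor \<open>1\<close> in the list lets a time step pass without a toss.
\<close>
primrec chain_expect ::
  "('a::polish_space \<Rightarrow> 'a measure) \<Rightarrow> ('a \<Rightarrow> real) list \<Rightarrow> 'a \<Rightarrow> real" where
  "chain_expect P [] = (\<lambda>_. 1)"
| "chain_expect P (g # gs) = (\<lambda>x. g x * (\<integral>y. chain_expect P gs y \<partial>P x))"

text \<open>
  The unnormalised filter: for \<open>X\<^sub>0\<close> distributed as \<open>\<mu>\<close>, and for \<open>g\<^sub>i(X\<^sub>i)\<close> the conditional
  probability of what is observed at time \<open>i\<close>, this is the law of the state at the first time after
  the observations, restricted to the event that they are made.
\<close>
primrec filter_measure ::
  "('a::polish_space \<Rightarrow> 'a measure) \<Rightarrow> ('a \<Rightarrow> real) list \<Rightarrow> 'a measure \<Rightarrow> 'a measure" where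
  "filter_measure P [] \<mu> = \<mu>"
| "filter_measure P (g # gs) \<mu> = filter_measure P gs (density \<mu> g \<bind> P)"

definition coin_prob :: "(nat \<Rightarrow> 'a \<Rightarrow> real) \<Rightarrow> nat \<Rightarrow> bool \<Rightarrow> 'a \<Rightarrow> real" where
  "coin_prob p k b = (if b then p k else (\<lambda>x. 1 - p k x))"

primrec coins :: "(nat \<Rightarrow> 'a \<Rightarrow> real) \<Rightarrow> nat \<Rightarrow> bool list \<Rightarrow> ('a \<Rightarrow> real) list" where
  "coins p k [] = []"
| "coins p k (b # zs) = coin_prob p k b # coins p (Suc k) zs"

definition word_prob ::
  "('a::polish_space \<Rightarrow> 'a measure) \<Rightarrow> (nat \<Rightarrow> 'a \<Rightarrow> real) \<Rightarrow> 'a measure \<Rightarrow> nat \<Rightarrow> bool list \<Rightarrow> real" where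
  "word_prob P p \<rho> n zs = (\<integral>x. chain_expect P (replicate n (\<lambda>_. 1) @ coins p n zs) x \<partial>\<rho>)"

lemma length_coins [simp]: "length (coins p k zs) = length zs"
  by (induction zs arbitrary: k) auto

lemma coins_append: "coins p k (ws @ zs) = coins p k ws @ coins p (k + length ws) zs"
  by (induction ws arbitrary: k) auto

lemma nth_coins: "i < length zs \<Longrightarrow> coins p k zs ! i = coin_prob p (k + i) (zs ! i)"
  by (induction zs arbitrary: k i) (auto simp: nth_Cons split: nat.split)

lemma unit_fun_coin_prob: "unit_fun (p k) \<Longrightarrow> unit_fun (coin_prob p k b)"
  by (auto simp: unit_fun_def coin_prob_def)

lemma unit_fun_coins: "(\<And>k. unit_fun (p k)) \<Longrightarrow> list_all unit_fun (coins p k zs)"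
  by (induction zs arbitrary: k) (auto simp: unit_fun_coin_prob)

lemma unit_fun_replicate: "list_all unit_fun (replicate n (\<lambda>_. 1))"
  by (induction n) auto

context
  fixes P :: "'a::polish_space \<Rightarrow> 'a measure"
  assumes P: "P \<in> borel \<rightarrow>\<^sub>M prob_algebra borel"
begin

lemma kernel_prob: "prob_space (P x)" and kernel_sets: "sets (P x) = sets borel"
  using measurable_space[OF P, of x] by (auto simp: space_prob_algebra)

lemma kernel_finite: "finite_measure (P x)"
  using kernel_prob by (rule prob_space.finite_measure)

lemma kernel_measure_1 [simp]: "measure (P x) (space (P x)) = 1"
  using kernel_prob by (rule prob_space.prob_space)

lemma unit_fun_kernel:
  assumes f: "unit_fun f"
  shows "unit_fun (\<lambda>x. \<integral>y. f y \<partial>P x)"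
proof -
  have "(\<integral>y. f y \<partial>P x) \<le> (\<integral>y. 1 \<partial>P x)" for x
    using integrable_unit_fun[OF kernel_finite kernel_sets f] f
    by (intro integral_mono) (auto simp: unit_fun_def kernel_finite finite_measure.integrable_const)
  moreover have "(\<lambda>x. \<integral>y. f y \<partial>P x) \<in> borel_measurable borel"
    using measurable_compose[OF measurable_prob_algebraD[OF P]
        integral_measurable_subprob_algebra[OF unit_funD(1)[OF f]]] .
  ultimately show ?thesis
    using f by (auto simp: unit_fun_def intro!: integral_nonneg)
qed

lemma unit_fun_chain: "list_all unit_fun gs \<Longrightarrow> unit_fun (chain_expect P gs)"
  by (induction gs) (auto intro!: unit_fun_mult unit_fun_kernel)

lemma integrable_kernel: "unit_fun f \<Longrightarrow> integrable (P x) f"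
  by (rule integrable_unit_fun[OF kernel_finite kernel_sets])

lemma chain_append: "chain_expect P (gs @ hs) x = chain_expect P (gs @ [chain_expect P hs]) x"
  by (induction gs arbitrary: x) simp_all

lemma chain_append_ones: "chain_expect P (gs @ replicate d (\<lambda>_. 1)) x = chain_expect P gs x"
proof -
  have ones: "chain_expect P (replicate d (\<lambda>_. 1)) = (\<lambda>_. 1)"
    by (induction d) simp_all
  show ?thesis
    by (induction gs arbitrary: x) (simp_all add: ones)
qed

lemma chain_coin_sum:
  assumes "list_all unit_fun gs" "list_all unit_fun hs" "unit_fun (p k)"
  shows "(\<Sum>b\<in>UNIV. chain_expect P (gs @ coin_prob p k b # hs) x) =
    chain_expect P (gs @ (\<lambda>_. 1) # hs) x"
  using assms(1)
proof (induction gs arbitrary: x)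
  case Nil
  show ?case
    by (simp add: UNIV_bool coin_prob_def algebra_simps)
next
  case (Cons g gs)
  have "integrable (P x) (chain_expect P (gs @ coin_prob p k b # hs))" for b
    using Cons.prems assms(2,3) unit_fun_coin_prob[of p k b]
    by (intro integrable_kernel unit_fun_chain) auto
  with Cons show ?case
    by (simp add: sum_distrib_left[symmetric] Bochner_Integration.integral_sum[symmetric])
qed

text \<open>
  Summing over all words for a block of tosses removes these tosses and leaves a gap, since the two
  outcomes of each toss have total probability \<open>1\<close>.
\<close>
lemma chain_word_sum:
  assumes "\<And>k. unit_fun (p k)" "list_all unit_fun gs" "list_all unit_fun hs"
  shows "(\<Sum>us\<in>words d. chain_expect P (gs @ coins p k us @ hs) x) =
    chain_expect P (gs @ replicate d (\<lambda>_. 1) @ hs) x"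
  using assms(2)
proof (induction d arbitrary: gs k)
  case 0
  then show ?case by (simp add: words_0)
next
  case (Suc d)
  have "(\<Sum>us\<in>words d. chain_expect P (gs @ coins p k (b # us) @ hs) x) =
      chain_expect P (gs @ coin_prob p k b # (replicate d (\<lambda>_. 1) @ hs)) x" for b
    using Suc.IH[of "gs @ [coin_prob p k b]" "Suc k"] Suc.prems unit_fun_coin_prob[of p k b] assms(1)
    by simp
  then show ?case
    using chain_coin_sum[of gs "replicate d (\<lambda>_. 1) @ hs" p k x] Suc.prems assms(1,3)
    by (simp add: sum_words_Suc unit_fun_replicate)
qed

lemma consistent_word_prob:
  assumes p: "\<And>k. unit_fun (p k)" and "prob_space \<rho>" and sets: "sets \<rho> = sets borel"
  shows "consistent (word_prob P p \<rho>)"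
proof -
  interpret prob_space \<rho> by fact
  have unit: "unit_fun (chain_expect P (replicate n (\<lambda>_. 1) @ coins p k zs))" for n k zs
    using p by (intro unit_fun_chain) (simp add: unit_fun_replicate unit_fun_coins)
  have int: "integrable \<rho> (chain_expect P (replicate n (\<lambda>_. 1) @ coins p k zs))" for n k zs
    using unit by (intro integrable_unit_fun[OF _ sets]) unfold_locales
  have 1: "0 \<le> word_prob P p \<rho> n zs" for n zs
    unfolding word_prob_def by (intro Bochner_Integration.integral_nonneg unit_funD(2)[OF unit])
  have 2: "word_prob P p \<rho> n [] = 1" for n
    using chain_append_ones[of "[]" n] by (simp add: word_prob_def prob_space)
  have 3: "(\<Sum>us\<in>words d. word_prob P p \<rho> n (xs @ us)) = word_prob P p \<rho> n xs" for n d xs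
  proof -
    have "(\<Sum>us\<in>words d. chain_expect P (replicate n (\<lambda>_. 1) @ coins p n (xs @ us)) x) =
        chain_expect P (replicate n (\<lambda>_. 1) @ coins p n xs) x" for x
      using chain_word_sum[where p = p and gs = "replicate n (\<lambda>_. 1) @ coins p n xs" and hs = "[]"
            and d = d and k = "n + length xs" and x = x, OF p]
        chain_append_ones[of "replicate n (\<lambda>_. 1) @ coins p n xs" d x] p
      by (simp add: coins_append unit_fun_replicate unit_fun_coins)
    then show ?thesis
      by (simp add: word_prob_def Bochner_Integration.integral_sum[symmetric] int)
  qed
  have 4: "(\<Sum>us\<in>words d. word_prob P p \<rho> n (us @ xs)) = word_prob P p \<rho> (n + d) xs" for n d xs
  proof -
    have "(\<Sum>us\<in>words d. chain_expect P (replicate n (\<lambda>_. 1) @ coins p n (us @ xs)) x) =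
        (\<Sum>us\<in>words d. chain_expect P (replicate n (\<lambda>_. 1) @ coins p n us @ coins p (n + d) xs) x)" for x
      by (intro sum.cong refl) (auto simp: words_def coins_append)
    then have "(\<Sum>us\<in>words d. chain_expect P (replicate n (\<lambda>_. 1) @ coins p n (us @ xs)) x) =
        chain_expect P (replicate (n + d) (\<lambda>_. 1) @ coins p (n + d) xs) x" for x
      using chain_word_sum[where p = p and gs = "replicate n (\<lambda>_. 1)" and hs = "coins p (n + d) xs"
            and d = d and k = n and x = x, OF p] p
      by (simp add: unit_fun_replicate unit_fun_coins replicate_add)
    then show ?thesis
      by (simp add: word_prob_def Bochner_Integration.integral_sum[symmetric] int)
  qed
  from 1 2 3 4 show ?thesis
    by (simp add: consistent_def)
qed

lemma filter_step:
  fixes \<mu> :: "'a measure"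
  assumes "finite_measure \<mu>" and sets: "sets \<mu> = sets borel" and g: "unit_fun g"
  shows "finite_measure (density \<mu> g \<bind> P)" and "sets (density \<mu> g \<bind> P) = sets borel"
    and "unit_fun f \<Longrightarrow>
      (\<integral>y. f y \<partial>(density \<mu> g \<bind> P)) = (\<integral>x. g x * (\<integral>y. f y \<partial>P x) \<partial>\<mu>)"
proof -
  interpret finite_measure \<mu> by fact
  note [measurable_cong] = sets
  have [measurable]: "g \<in> borel_measurable borel"
    using g by (rule unit_funD)
  have P_sub [measurable]: "P \<in> density \<mu> g \<rightarrow>\<^sub>M subprob_algebra borel"
    using measurable_prob_algebraD[OF P] by measurable
  have space: "space \<mu> = UNIV"
    using sets_eq_imp_space_eq[OF sets] by simp
  have "(\<integral>\<^sup>+x. ennreal (g x) \<partial>\<mu>) \<le> (\<integral>\<^sup>+x. 1 \<partial>\<mu>)"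
    using g by (intro nn_integral_mono) (auto simp: unit_fun_def)
  also have "\<dots> < \<infinity>"
    by (simp add: emeasure_eq_measure)
  finally have "(\<integral>\<^sup>+x. ennreal (g x) \<partial>\<mu>) < \<infinity>" .
  then have dens: "finite_measure (density \<mu> g)"
    by (intro finite_measureI) (simp add: emeasure_density space less_top)
  show s: "sets (density \<mu> g \<bind> P) = sets borel"
    by (rule sets_bind) (auto simp: kernel_sets space)
  have "(\<integral>\<^sup>+y. 1 \<partial>(density \<mu> g \<bind> P)) = (\<integral>\<^sup>+x. \<integral>\<^sup>+y. 1 \<partial>P x \<partial>density \<mu> g)"
    by (rule nn_integral_bind[OF _ P_sub]) simp
  also have "\<dots> = emeasure (density \<mu> g) (space \<mu>)"
    by (simp add: prob_space.emeasure_space_1[OF kernel_prob])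
  finally show "finite_measure (density \<mu> g \<bind> P)"
    using finite_measure.emeasure_finite[OF dens, of "space \<mu>"] by (intro finite_measureI) simp
  assume f: "unit_fun f"
  note [measurable] = unit_funD(1)[OF f]
  have [measurable]: "(\<lambda>x. \<integral>y. f y \<partial>P x) \<in> borel_measurable borel"
    using unit_fun_kernel[OF f] by (rule unit_funD)
  have "(\<integral>y. f y \<partial>(density \<mu> g \<bind> P)) = (\<integral>x. \<integral>y. f y \<partial>P x \<partial>density \<mu> g)"
    by (rule integral_bind[where K = borel and B = 1 and B' = 1])
      (use f in \<open>auto simp: unit_fun_def dens P_sub prob_space.emeasure_space_1[OF kernel_prob]\<close>)
  also have "\<dots> = (\<integral>x. g x *\<^sub>R (\<integral>y. f y \<partial>P x) \<partial>\<mu>)"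
    by (rule integral_density) (use g in \<open>auto simp: unit_fun_def\<close>)
  finally show "(\<integral>y. f y \<partial>(density \<mu> g \<bind> P)) = (\<integral>x. g x * (\<integral>y. f y \<partial>P x) \<partial>\<mu>)"
    by simp
qed

text \<open>
  The Markov property in the form that is needed: given the observations, the future depends on the
  past only through the filter.
\<close>
lemma filter_measure:
  fixes \<mu> :: "'a measure"
  assumes "finite_measure \<mu>" "sets \<mu> = sets borel" "list_all unit_fun gs"
  shows "finite_measure (filter_measure P gs \<mu>)" and "sets (filter_measure P gs \<mu>) = sets borel"
    and "list_all unit_fun hs \<Longrightarrow>
      (\<integral>x. chain_expect P hs x \<partial>filter_measure P gs \<mu>) = (\<integral>x. chain_expect P (gs @ hs) x \<partial>\<mu>)"
  using assms
  by (induction gs arbitrary: \<mu>) (simp_all add: filter_step unit_fun_chain)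

lemma integral_kernel_iterate:
  fixes \<mu> :: "'a measure"
  assumes "prob_space \<mu>" "sets \<mu> = sets borel" and f: "unit_fun f"
  shows "(\<integral>x. chain_expect P (replicate n (\<lambda>_. 1) @ [f]) x \<partial>\<mu>) =
    (\<integral>x. f x \<partial>kernel_iterate P n \<mu>)"
  using assms(1,2)
proof (induction n arbitrary: \<mu>)
  case 0
  show ?case
    by (simp add: kernel_iterate_def)
next
  case (Suc n)
  have \<mu>: "\<mu> \<in> space (prob_algebra borel)"
    using Suc.prems by (simp add: space_prob_algebra)
  have fin: "finite_measure \<mu>"
    using Suc.prems(1) by (rule prob_space.finite_measure)
  have P': "P \<in> \<mu> \<rightarrow>\<^sub>M subprob_algebra borel"
    using measurable_prob_algebraD[OF P] by (simp add: measurable_cong_sets[OF Suc.prems(2) refl])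
  have "prob_space (\<mu> \<bind> P)"
    using prob_space.prob_space_bind[OF Suc.prems(1) _ P'] kernel_prob by simp
  moreover have "sets (\<mu> \<bind> P) = sets borel"
    by (rule sets_bind'[OF \<mu> P])
  moreover have "(\<integral>x. chain_expect P (replicate (Suc n) (\<lambda>_. 1) @ [f]) x \<partial>\<mu>) =
      (\<integral>x. chain_expect P (replicate n (\<lambda>_. 1) @ [f]) x \<partial>(\<mu> \<bind> P))"
    using filter_step(3)[OF fin Suc.prems(2) unit_fun_one,
        of "chain_expect P (replicate n (\<lambda>_. 1) @ [f])"] f
    by (simp add: density_1 unit_fun_chain unit_fun_replicate)
  moreover have "kernel_iterate P (Suc n) \<mu> = kernel_iterate P n (\<mu> \<bind> P)"
    using funpow_swap1[of "\<lambda>\<rho>. \<rho> \<bind> P" n \<mu>] by (simp add: kernel_iterate_def)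
  ultimately show ?case
    using Suc.IH[of "\<mu> \<bind> P"] by simp
qed

end

section \<open>Overlap of the futures implies mixing\<close>

text \<open>
  The overlap at each pair of points passes to mixtures, because a minimum of integrals dominates
  the integral of the minimum over the product measure. The gap from which the overlap holds depends
  on the pair, so some \<open>\<eta>\<close> is lost; dominated convergence of the truncation at \<open>c\<close> keeps it small.
\<close>
lemma overlap_of_integrals:
  fixes M N :: "'a::polish_space measure" and h :: "nat \<Rightarrow> 'i \<Rightarrow> 'a \<Rightarrow> real"
  assumes "finite_measure M" "finite_measure N"
    and sets: "sets M = sets borel" "sets N = sets borel"
    and fin: "\<And>d. finite (Z d)" and h: "\<And>d z. unit_fun (h d z)" and c: "0 \<le> c" and \<eta>: "0 < \<eta>"
    and overlap: "\<And>x y. \<forall>\<^sub>F d in sequentially. c \<le> (\<Sum>z\<in>Z d. min (h d z x) (h d z y))"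
  shows "\<forall>\<^sub>F d in sequentially. c * (measure M (space M) * measure N (space N)) - \<eta> \<le>
    (\<Sum>z\<in>Z d. min (measure N (space N) * (\<integral>x. h d z x \<partial>M)) (measure M (space M) * (\<integral>y. h d z y \<partial>N)))"
proof -
  interpret M: finite_measure M by fact
  interpret N: finite_measure N by fact
  interpret pair_sigma_finite M N ..
  interpret MN: finite_measure "M \<Otimes>\<^sub>M N"
    by (rule finite_measure_pair_measure) fact+
  note [measurable_cong] = sets
  have [measurable]: "h d z \<in> borel_measurable borel" for d z
    using h by (rule unit_funD)
  define K where "K = M \<Otimes>\<^sub>M N"
  have bound: "\<bar>h d z x\<bar> \<le> 1" for d z x
    using unit_funD(2,3)[OF h, of d z x] by simp
  have int1: "integrable K (\<lambda>\<omega>. h d z (fst \<omega>))" and int2: "integrable K (\<lambda>\<omega>. h d z (snd \<omega>))" for d z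
    unfolding K_def by (rule MN.integrable_const_bound[where B = 1]; simp add: bound)+
  have int_min: "integrable K (\<lambda>\<omega>. min (h d z (fst \<omega>)) (h d z (snd \<omega>)))" for d z
    using int1 int2 by (rule integrable_min)
  have fst: "(\<integral>\<omega>. h d z (fst \<omega>) \<partial>K) = measure N (space N) * (\<integral>x. h d z x \<partial>M)" for d z
    using integral_fst'[OF int1[unfolded K_def]] by (simp add: K_def)
  have snd: "(\<integral>\<omega>. h d z (snd \<omega>) \<partial>K) = measure M (space M) * (\<integral>y. h d z y \<partial>N)" for d z
    using integral_fst'[OF int2[unfolded K_def]] by (simp add: K_def)
  define \<Psi> where "\<Psi> d \<omega> = (\<Sum>z\<in>Z d. min (h d z (fst \<omega>)) (h d z (snd \<omega>)))" for d \<omega>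
  have \<Psi>_nonneg: "0 \<le> \<Psi> d \<omega>" for d \<omega>
    unfolding \<Psi>_def by (intro sum_nonneg) (simp add: unit_funD[OF h])
  have int_\<Psi>: "integrable K (\<Psi> d)" for d
    unfolding \<Psi>_def by (intro Bochner_Integration.integrable_sum int_min)
  have \<Psi>_le: "(\<integral>\<omega>. \<Psi> d \<omega> \<partial>K) \<le> (\<Sum>z\<in>Z d. min (measure N (space N) * (\<integral>x. h d z x \<partial>M))
      (measure M (space M) * (\<integral>y. h d z y \<partial>N)))" for d
    unfolding \<Psi>_def Bochner_Integration.integral_sum[OF int_min] fst[symmetric] snd[symmetric]
    by (intro sum_mono min.boundedI integral_mono int_min int1 int2) auto
  have "(\<lambda>d. \<integral>\<omega>. min c (\<Psi> d \<omega>) \<partial>K) \<longlonglongrightarrow> (\<integral>\<omega>. c \<partial>K)"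
  proof (rule integral_dominated_convergence[where w = "\<lambda>_. c"])
    show "integrable K (\<lambda>_. c)"
      by (simp add: K_def)
    show "AE \<omega> in K. (\<lambda>d. min c (\<Psi> d \<omega>)) \<longlonglongrightarrow> c"
    proof (rule AE_I2)
      fix \<omega>
      have "\<forall>\<^sub>F d in sequentially. min c (\<Psi> d \<omega>) = c"
        using overlap[of "fst \<omega>" "snd \<omega>"] by eventually_elim (simp add: \<Psi>_def)
      then show "(\<lambda>d. min c (\<Psi> d \<omega>)) \<longlonglongrightarrow> c"
        by (rule tendsto_eventually)
    qed
    show "AE \<omega> in K. norm (min c (\<Psi> d \<omega>)) \<le> c" for d
      using c \<Psi>_nonneg[of d] by (intro AE_I2) (simp add: min_def)
  qed (use int_\<Psi> in \<open>auto intro!: borel_measurable_min borel_measurable_integrable\<close>)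
  moreover have "(\<integral>\<omega>. c \<partial>K) = c * (measure M (space M) * measure N (space N))"
    using integral_fst'[of "\<lambda>_. c"] by (auto simp: K_def mult.assoc)
  ultimately have "\<forall>\<^sub>F d in sequentially.
      c * (measure M (space M) * measure N (space N)) - \<eta> < (\<integral>\<omega>. min c (\<Psi> d \<omega>) \<partial>K)"
    using \<eta> by (intro order_tendstoD(1)) auto
  then show ?thesis
  proof eventually_elim
    case (elim d)
    also have "(\<integral>\<omega>. min c (\<Psi> d \<omega>) \<partial>K) \<le> (\<integral>\<omega>. \<Psi> d \<omega> \<partial>K)"
      using int_\<Psi> by (intro integral_mono integrable_min) (auto simp: K_def)
    also note \<Psi>_le
    finally show ?case
      by simp
  qed
qed

lemma midpoint_square_bound:
  fixes a b s t u :: real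
  assumes "0 \<le> a" "0 \<le> b"
  shows "min a b * ((s - t)\<^sup>2 / 2) \<le> a * (s - u)\<^sup>2 + b * (t - u)\<^sup>2"
proof -
  have "(s - u)\<^sup>2 + (t - u)\<^sup>2 = (s - t)\<^sup>2 / 2 + (s + t - 2 * u)\<^sup>2 / 2"
    by (simp add: power2_eq_square field_simps)
  then have "(s - t)\<^sup>2 / 2 \<le> (s - u)\<^sup>2 + (t - u)\<^sup>2"
    by simp
  then have "min a b * ((s - t)\<^sup>2 / 2) \<le> min a b * (s - u)\<^sup>2 + min a b * (t - u)\<^sup>2"
    using assms unfolding distrib_left[symmetric] by (intro mult_left_mono) auto
  also have "\<dots> \<le> a * (s - u)\<^sup>2 + b * (t - u)\<^sup>2"
    by (intro add_mono mult_right_mono) auto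
  finally show ?thesis .
qed

lemma variance_pairs:
  fixes w F :: "'i \<Rightarrow> real"
  assumes "(\<Sum>i\<in>I. w i) = 1"
  shows "(\<Sum>i\<in>I. \<Sum>j\<in>I. w i * w j * (F i - F j)\<^sup>2) = 2 * (\<Sum>i\<in>I. w i * (F i - (\<Sum>i\<in>I. w i * F i))\<^sup>2)"
proof -
  define m s where "m = (\<Sum>i\<in>I. w i * F i)" and "s = (\<Sum>i\<in>I. w i * (F i)\<^sup>2)"
  have "w i * w j * (F i - F j)\<^sup>2 = w i * (F i)\<^sup>2 * w j - 2 * (w i * F i) * (w j * F j) + w i * (w j * (F j)\<^sup>2)"
    for i j by (simp add: power2_eq_square algebra_simps)
  then have "(\<Sum>i\<in>I. \<Sum>j\<in>I. w i * w j * (F i - F j)\<^sup>2) = 2 * s - 2 * m * m"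
    by (simp add: sum.distrib sum_subtractf sum_distrib_left[symmetric] sum_distrib_right[symmetric]
        assms m_def[symmetric] s_def[symmetric])
  moreover have "w i * (F i - m)\<^sup>2 = w i * (F i)\<^sup>2 - 2 * m * (w i * F i) + m * m * w i" for i
    by (simp add: power2_eq_square algebra_simps)
  then have "(\<Sum>i\<in>I. w i * (F i - m)\<^sup>2) = s - m * m"
    by (simp add: sum.distrib sum_subtractf sum_distrib_left[symmetric]
        assms m_def[symmetric] s_def[symmetric])
  ultimately show ?thesis
    by (simp add: m_def)
qed

text \<open>
  Draw two independent copies of the early tosses, with words \<open>ws\<close> and \<open>vs\<close>. The futures given \<open>ws\<close>
  and given \<open>vs\<close> share mass \<open>c\<close> asymptotically, and on the common part the late function must miss
  \<open>F ws\<close> or \<open>F vs\<close> by an amount of order \<open>F ws - F vs\<close>. The mean square of this difference is twice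
  the variance of \<open>F\<close>. There are only finitely many pairs of words, so one gap serves them all.
\<close>
lemma mixing_word_prob:
  fixes P :: "'a::polish_space \<Rightarrow> 'a measure" and \<rho> :: "'a measure"
  assumes P: "P \<in> borel \<rightarrow>\<^sub>M prob_algebra borel"
    and p: "\<And>k. unit_fun (p k)" and \<rho>: "prob_space \<rho>" and sets: "sets \<rho> = sets borel"
    and c: "0 \<le> c"
    and overlap: "\<And>m x y. \<forall>\<^sub>F d in sequentially. \<forall>l. c \<le> (\<Sum>zs\<in>words l.
      min (chain_expect P (replicate d (\<lambda>_. 1) @ coins p (m + d) zs) x)
          (chain_expect P (replicate d (\<lambda>_. 1) @ coins p (m + d) zs) y))"
  shows "mixing (c / 2) (word_prob P p \<rho>)"
  unfolding mixing_def
proof (intro allI impI)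
  fix n l :: nat and F :: "bool list \<Rightarrow> real" and l' :: "nat \<Rightarrow> nat"
    and F' :: "nat \<Rightarrow> bool list \<Rightarrow> real" and \<epsilon> :: real
  assume \<epsilon>: "0 < \<epsilon>"
  define q where "q = word_prob P p \<rho> n"
  define early where "early ws = replicate n (\<lambda>_. 1) @ coins p n ws" for ws
  define late where "late d zs = replicate d (\<lambda>_. 1) @ coins p (n + l + d) zs" for d zs
  define K where "K ws = filter_measure P (early ws) \<rho>" for ws
  have fin: "finite_measure \<rho>"
    using \<rho> by (rule prob_space.finite_measure)
  have unit_early: "list_all unit_fun (early ws)" for ws
    by (simp add: early_def unit_fun_replicate unit_fun_coins p)
  have unit_late: "list_all unit_fun (late d zs)" for d zs
    by (simp add: late_def unit_fun_replicate unit_fun_coins p)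
  note K = filter_measure[OF P fin sets unit_early, folded K_def]
  have consistent: "consistent (word_prob P p \<rho>)"
    by (rule consistent_word_prob[OF P p \<rho> sets])
  have mass: "measure (K ws) (space (K ws)) = q ws" for ws
    using K(3)[where hs = "[]"] by (simp add: q_def word_prob_def early_def)
  define J where "J d ws zs = (\<integral>x. chain_expect P (late d zs) x \<partial>K ws)" for d ws zs
  have J_nonneg: "0 \<le> J d ws zs" for d ws zs
    unfolding J_def
    by (intro Bochner_Integration.integral_nonneg unit_funD(2)[OF unit_fun_chain[OF P unit_late]])
  have J_sum: "(\<Sum>us\<in>words d. q (ws @ us @ zs)) = J d ws zs" if "ws \<in> words l" for d ws zs
  proof -
    have int: "integrable \<rho> (chain_expect P (early (ws @ us @ zs)))" for us
      by (intro integrable_unit_fun[OF fin sets] unit_fun_chain[OF P] unit_early)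
    have "(\<Sum>us\<in>words d. q (ws @ us @ zs)) =
        (\<integral>x. (\<Sum>us\<in>words d. chain_expect P (early (ws @ us @ zs)) x) \<partial>\<rho>)"
      by (simp add: q_def word_prob_def early_def[symmetric] Bochner_Integration.integral_sum[OF int])
    also have "\<dots> = (\<integral>x. (\<Sum>us\<in>words d. chain_expect P
        (early ws @ coins p (n + l) us @ coins p (n + l + d) zs) x) \<partial>\<rho>)"
      using that by (intro Bochner_Integration.integral_cong sum.cong refl)
        (auto simp: words_def early_def coins_append)
    also have "\<dots> = J d ws zs"
      unfolding J_def K(3)[OF unit_late]
      by (simp add: chain_word_sum[OF P p] unit_early unit_fun_coins p late_def)
    finally show ?thesis .
  qed
  define X where "X d = word_avg (word_prob P p \<rho>) n (l + d + l' d)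
    (\<lambda>xs. (F (take l xs) - F' d (drop (l + d) xs))\<^sup>2)" for d
  have X: "X d = (\<Sum>ws\<in>words l. \<Sum>zs\<in>words (l' d). J d ws zs * (F ws - F' d zs)\<^sup>2)" for d
  proof -
    have "X d = (\<Sum>ws\<in>words l. \<Sum>us\<in>words d. \<Sum>zs\<in>words (l' d).
        q (ws @ us @ zs) * (F ws - F' d zs)\<^sup>2)"
      unfolding X_def word_avg_def add.assoc sum_words_add q_def[symmetric]
      by (intro sum.cong refl) (auto simp: words_def)
    also have "\<dots> = (\<Sum>ws\<in>words l. \<Sum>zs\<in>words (l' d). \<Sum>us\<in>words d.
        q (ws @ us @ zs) * (F ws - F' d zs)\<^sup>2)"
      by (intro sum.cong refl sum.swap)
    also have "\<dots> = (\<Sum>ws\<in>words l. \<Sum>zs\<in>words (l' d). J d ws zs * (F ws - F' d zs)\<^sup>2)"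
      by (intro sum.cong refl) (simp add: sum_distrib_right[symmetric] J_sum)
    finally show ?thesis .
  qed
  have q_sum: "(\<Sum>ws\<in>words l. q ws) = 1"
    using word_avg_const[OF consistent, of n l 1] by (simp add: word_avg_def q_def)
  have q_nonneg: "0 \<le> q ws" for ws
    using consistent by (simp add: consistent_def q_def)
  define V where "V = word_avg (word_prob P p \<rho>) n l
    (\<lambda>xs. (F xs - word_avg (word_prob P p \<rho>) n l F)\<^sup>2)"
  have V: "(\<Sum>ws\<in>words l. \<Sum>vs\<in>words l. q ws * q vs * (F ws - F vs)\<^sup>2) = 2 * V"
    using variance_pairs[OF q_sum, of F] by (simp add: V_def word_avg_def q_def)
  define C where "C = (\<Sum>ws\<in>words l. \<Sum>vs\<in>words l. (F ws - F vs)\<^sup>2)"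
  have C: "0 \<le> C"
    unfolding C_def by (intro sum_nonneg) simp
  \<comment> \<open>The losses of all pairs of words, weighted by \<open>(F ws - F vs)\<^sup>2\<close>, must add up to at most \<open>\<epsilon>\<close>.\<close>
  define \<eta> where "\<eta> = \<epsilon> / (C + 1)"
  have \<eta>: "0 < \<eta>"
    using \<epsilon> C by (simp add: \<eta>_def)
  have \<eta>C: "\<eta> * C \<le> \<epsilon>"
    using \<epsilon> C by (simp add: \<eta>_def field_simps)
  have "\<forall>\<^sub>F d in sequentially. c * (q ws * q vs) - \<eta> \<le>
      (\<Sum>zs\<in>words (l' d). min (q vs * J d ws zs) (q ws * J d vs zs))" for ws vs
    unfolding mass[symmetric] J_def
  proof (rule overlap_of_integrals[OF K(1) K(1) K(2) K(2) _ _ c \<eta>])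
    show "\<forall>\<^sub>F d in sequentially. c \<le> (\<Sum>z\<in>words (l' d).
        min (chain_expect P (late d z) x) (chain_expect P (late d z) y))" for x y
      using overlap[of "n + l" x y] by eventually_elim (simp add: late_def)
  qed (simp_all add: unit_fun_chain[OF P unit_late])
  then have "\<forall>\<^sub>F d in sequentially. \<forall>ws\<in>words l. \<forall>vs\<in>words l. c * (q ws * q vs) - \<eta> \<le>
      (\<Sum>zs\<in>words (l' d). min (q vs * J d ws zs) (q ws * J d vs zs))"
    by (intro eventually_ball_finite ballI) simp_all
  then show "\<forall>\<^sub>F d in sequentially. c / 2 * word_avg (word_prob P p \<rho>) n l
      (\<lambda>xs. (F xs - word_avg (word_prob P p \<rho>) n l F)\<^sup>2) - \<epsilon>
    \<le> word_avg (word_prob P p \<rho>) n (l + d + l' d)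
      (\<lambda>xs. (F (take l xs) - F' d (drop (l + d) xs))\<^sup>2)"
    unfolding V_def[symmetric] X_def[symmetric]
  proof eventually_elim
    case (elim d)
    define S where "S ws = (\<Sum>zs\<in>words (l' d). J d ws zs * (F ws - F' d zs)\<^sup>2)" for ws
    have pair: "(c * (q ws * q vs) - \<eta>) * ((F ws - F vs)\<^sup>2 / 2) \<le> q vs * S ws + q ws * S vs"
      if "ws \<in> words l" "vs \<in> words l" for ws vs
    proof -
      have "(c * (q ws * q vs) - \<eta>) * ((F ws - F vs)\<^sup>2 / 2) \<le>
          (\<Sum>zs\<in>words (l' d). min (q vs * J d ws zs) (q ws * J d vs zs)) * ((F ws - F vs)\<^sup>2 / 2)"
        using elim that by (intro mult_right_mono) auto
      also have "\<dots> \<le> (\<Sum>zs\<in>words (l' d). q vs * J d ws zs * (F ws - F' d zs)\<^sup>2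
          + q ws * J d vs zs * (F vs - F' d zs)\<^sup>2)"
        unfolding sum_distrib_right
        by (intro sum_mono midpoint_square_bound mult_nonneg_nonneg q_nonneg J_nonneg)
      also have "\<dots> = q vs * S ws + q ws * S vs"
        by (simp add: S_def sum.distrib sum_distrib_left mult.assoc)
      finally show ?thesis .
    qed
    have "c * V - \<eta> * C / 2 =
        (\<Sum>ws\<in>words l. \<Sum>vs\<in>words l. (c * (q ws * q vs) - \<eta>) * ((F ws - F vs)\<^sup>2 / 2))"
    proof -
      have "(c * (q ws * q vs) - \<eta>) * ((F ws - F vs)\<^sup>2 / 2) =
          c / 2 * (q ws * q vs * (F ws - F vs)\<^sup>2) - \<eta> / 2 * (F ws - F vs)\<^sup>2" for ws vs
        by (simp add: field_simps)
      then show ?thesis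
        by (simp only: sum_subtractf sum_distrib_left[symmetric] V C_def[symmetric])
    qed
    also have "\<dots> \<le> (\<Sum>ws\<in>words l. \<Sum>vs\<in>words l. q vs * S ws + q ws * S vs)"
      by (intro sum_mono pair)
    also have "\<dots> = 2 * X d"
      by (simp add: sum.distrib sum_distrib_left[symmetric] sum_distrib_right[symmetric] q_sum
          X S_def[symmetric])
    finally show ?case
      using \<eta>C \<epsilon> by simp
  qed
qed

section \<open>Overlap of the coins along two nearby paths\<close>
lemma sum_prod_words:
  fixes h :: "nat \<Rightarrow> bool \<Rightarrow> real"
  shows "(\<Sum>zs\<in>words l. \<Prod>i<l. h i (zs ! i)) = (\<Prod>i<l. \<Sum>b\<in>UNIV. h i b)"
proof (induction l)
  case 0
  show ?case by (simp add: words_0)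
next
  case (Suc l)
  have "words 1 = range (\<lambda>b. [b])"
    by (auto simp: words_def length_Suc_conv)
  then have "(\<Sum>zs\<in>words (Suc l). \<Prod>i<Suc l. h i (zs ! i)) =
      (\<Sum>ws\<in>words l. \<Sum>b\<in>UNIV. \<Prod>i<Suc l. h i ((ws @ [b]) ! i))"
    using sum_words_add[of "\<lambda>zs. \<Prod>i<Suc l. h i (zs ! i)" l 1] by (simp add: sum.reindex inj_on_def)
  also have "\<dots> = (\<Sum>ws\<in>words l. \<Sum>b\<in>UNIV. (\<Prod>i<l. h i (ws ! i)) * h l b)"
    by (intro sum.cong refl) (auto simp: words_def nth_append)
  also have "\<dots> = (\<Prod>i<Suc l. \<Sum>b\<in>UNIV. h i b)"
    by (simp add: sum_distrib_left[symmetric] sum_distrib_right[symmetric] Suc.IH)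
  finally show ?case .
qed

text \<open>
  The deficit \<open>1 - \<Sum>\<^sub>b \<surd>(u\<^sub>b v\<^sub>b)\<close> of the affinity of two coins is quadratic in \<open>u - v\<close> because the
  success probabilities stay away from \<open>0\<close> and \<open>1\<close>; this bounds the contribution of one outcome.
\<close>
lemma sqrt_mult_ge:
  fixes u v :: real
  assumes "u \<in> {1/4..3/4}" "v \<in> {1/4..3/4}"
  shows "(u + v) / 2 - (u - v)\<^sup>2 \<le> sqrt (u * v)"
proof (rule real_le_rsqrt)
  define s \<delta> where "s = (u + v) / 2" and "\<delta> = (u - v)\<^sup>2"
  have s: "1/4 \<le> s"
    using assms by (simp add: s_def)
  have "\<bar>u - v\<bar> \<le> 1/2"
    using assms unfolding atLeastAtMost_iff by linarith
  then have "\<delta> \<le> (1/2)\<^sup>2"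
    unfolding \<delta>_def using abs_le_square_iff[of "u - v" "1/2"] by simp
  then have "\<delta> \<le> 2 * s - 1/4"
    using s by (simp add: power2_eq_square)
  then have "\<delta> * \<delta> \<le> \<delta> * (2 * s - 1/4)"
    by (intro mult_left_mono) (simp_all add: \<delta>_def)
  moreover have "u * v = s * s - \<delta> / 4"
    by (simp add: s_def \<delta>_def power2_eq_square field_simps)
  ultimately have "(s - \<delta>)\<^sup>2 \<le> u * v"
    by (simp add: power2_eq_square algebra_simps)
  then show "((u + v) / 2 - (u - v)\<^sup>2)\<^sup>2 \<le> u * v"
    by (simp add: s_def \<delta>_def)
qed

text \<open>
  Two product laws of coins are compared through their Hellinger affinity, which is a product over the
  coins, with factors \<open>1 - O((u\<^sub>i - v\<^sub>i)\<^sup>2)\<close>. Since the product of two numbers is that of their minimum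
  and maximum, the Cauchy-Schwarz inequality bounds the squared affinity by twice the overlap.
\<close>
lemma coin_overlap:
  fixes u v :: "nat \<Rightarrow> real"
  assumes u: "\<And>i. u i \<in> {1/4..3/4}" and v: "\<And>i. v i \<in> {1/4..3/4}"
    and close: "(\<Sum>i<l. (4 * (u i - v i))\<^sup>2) \<le> 1"
  shows "1/4 \<le> (\<Sum>zs\<in>words l. min (\<Prod>i<l. if zs ! i then u i else 1 - u i)
    (\<Prod>i<l. if zs ! i then v i else 1 - v i))"
proof -
  define A B where "A zs = (\<Prod>i<l. if zs ! i then u i else 1 - u i)"
    and "B zs = (\<Prod>i<l. if zs ! i then v i else 1 - v i)" for zs
  have u': "0 \<le> u i" "u i \<le> 1" and v': "0 \<le> v i" "v i \<le> 1" for i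
    using u[of i] v[of i] by auto
  have A: "0 \<le> A zs" and B: "0 \<le> B zs" for zs
    unfolding A_def B_def using u' v' by (auto intro!: prod_nonneg)
  have "(\<Sum>zs\<in>words l. A zs) = (\<Prod>i<l. \<Sum>b\<in>UNIV. if b then u i else 1 - u i)"
    unfolding A_def by (rule sum_prod_words[of "\<lambda>i b. if b then u i else 1 - u i"])
  then have sum_A: "(\<Sum>zs\<in>words l. A zs) = 1"
    by (simp add: UNIV_bool)
  have "(\<Sum>zs\<in>words l. B zs) = (\<Prod>i<l. \<Sum>b\<in>UNIV. if b then v i else 1 - v i)"
    unfolding B_def by (rule sum_prod_words[of "\<lambda>i b. if b then v i else 1 - v i"])
  then have sum_B: "(\<Sum>zs\<in>words l. B zs) = 1"
    by (simp add: UNIV_bool)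
  define h where "h i b = (if b then sqrt (u i * v i) else sqrt ((1 - u i) * (1 - v i)))" for i b
  have "sqrt (A zs * B zs) = (\<Prod>i<l. h i (zs ! i))" for zs
    unfolding A_def B_def prod.distrib[symmetric] h_def
    by (induction l) (auto simp: real_sqrt_mult)
  then have affinity: "(\<Sum>zs\<in>words l. sqrt (A zs * B zs)) = (\<Prod>i<l. h i True + h i False)"
    by (simp add: sum_prod_words UNIV_bool add.commute)
  have "7/8 \<le> 1 - (\<Sum>i<l. 2 * (u i - v i)\<^sup>2)"
  proof -
    have "(\<Sum>i<l. (4 * (u i - v i))\<^sup>2) = 8 * (\<Sum>i<l. 2 * (u i - v i)\<^sup>2)"
      unfolding sum_distrib_left by (intro sum.cong refl) (simp add: power2_eq_square algebra_simps)
    then show ?thesis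
      using close by simp
  qed
  also have "\<dots> \<le> (\<Prod>i<l. 1 - 2 * (u i - v i)\<^sup>2)"
  proof (rule Weierstrass_prod_ineq)
    fix i
    have "\<bar>u i - v i\<bar> \<le> 1/2"
      using u[of i] v[of i] unfolding atLeastAtMost_iff by linarith
    then have "(u i - v i)\<^sup>2 \<le> (1/2)\<^sup>2"
      using abs_le_square_iff[of "u i - v i" "1/2"] by simp
    then show "2 * (u i - v i)\<^sup>2 \<in> {0..1}"
      by (simp add: power2_eq_square)
  qed
  also have "\<dots> \<le> (\<Prod>i<l. h i True + h i False)"
  proof (intro prod_mono conjI)
    fix i
    have "\<bar>u i - v i\<bar> \<le> 1/2"
      using u[of i] v[of i] unfolding atLeastAtMost_iff by linarith
    then have "(u i - v i)\<^sup>2 \<le> (1/2)\<^sup>2"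
      using abs_le_square_iff[of "u i - v i" "1/2"] by simp
    then show "0 \<le> 1 - 2 * (u i - v i)\<^sup>2"
      by (simp add: power2_eq_square)
    have "(1 - u i + (1 - v i)) / 2 - (1 - u i - (1 - v i))\<^sup>2 \<le> sqrt ((1 - u i) * (1 - v i))"
      using u[of i] v[of i] by (intro sqrt_mult_ge) auto
    moreover have "(1 - u i - (1 - v i))\<^sup>2 = (u i - v i)\<^sup>2"
      by (simp add: power2_eq_square algebra_simps)
    ultimately show "1 - 2 * (u i - v i)\<^sup>2 \<le> h i True + h i False"
      using sqrt_mult_ge[OF u[of i] v[of i]] by (simp add: h_def add_divide_distrib diff_divide_distrib)
  qed
  finally have "(7/8)\<^sup>2 \<le> (\<Sum>zs\<in>words l. sqrt (A zs * B zs))\<^sup>2"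
    unfolding affinity by (intro power_mono) auto
  also have "\<dots> = (\<Sum>zs\<in>words l. sqrt (min (A zs) (B zs)) * sqrt (max (A zs) (B zs)))\<^sup>2"
    by (intro arg_cong[where f = "\<lambda>x. x\<^sup>2"] sum.cong refl)
      (simp add: real_sqrt_mult min_def max_def mult.commute)
  also have "\<dots> \<le> (\<Sum>zs\<in>words l. (sqrt (min (A zs) (B zs)))\<^sup>2) * (\<Sum>zs\<in>words l. (sqrt (max (A zs) (B zs)))\<^sup>2)"
    by (rule Cauchy_Schwarz_ineq_sum)
  also have "\<dots> = (\<Sum>zs\<in>words l. min (A zs) (B zs)) * (\<Sum>zs\<in>words l. max (A zs) (B zs))"
    using A B by (simp add: le_max_iff_disj)
  also have "\<dots> \<le> (\<Sum>zs\<in>words l. min (A zs) (B zs)) * (\<Sum>zs\<in>words l. A zs + B zs)"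
    using A B by (intro mult_left_mono sum_mono sum_nonneg) auto
  also have "\<dots> = (\<Sum>zs\<in>words l. min (A zs) (B zs)) * 2"
    by (simp add: sum.distrib sum_A sum_B)
  finally show ?thesis
    by (simp add: A_def B_def power2_eq_square)
qed

lemma measurable_path_prod:
  assumes "list_all unit_fun gs"
  shows "(\<lambda>\<omega>. \<Prod>i<length gs. (gs ! i) (\<omega> i)) \<in> borel_measurable path_space"
proof (intro borel_measurable_prod)
  fix i assume "i \<in> {..<length gs}"
  then have "gs ! i \<in> borel_measurable borel"
    using assms by (auto simp: list_all_length unit_fun_def)
  then show "(\<lambda>\<omega>. (gs ! i) (\<omega> i)) \<in> borel_measurable path_space"
    by (rule measurable_compose[rotated]) simp
qed

lemma path_prod_bounds:
  fixes \<omega> :: "nat \<Rightarrow> 'a::topological_space"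
  assumes "list_all unit_fun gs"
  shows "0 \<le> (\<Prod>i<length gs. (gs ! i) (\<omega> i))" "(\<Prod>i<length gs. (gs ! i) (\<omega> i)) \<le> 1"
  using assms by (auto simp: list_all_length unit_fun_def intro!: prod_nonneg prod_le_1)

section \<open>Expectations over path space\<close>
lemma integral_chain_law_step:
  fixes P :: "'a::polish_space \<Rightarrow> 'a measure"
  assumes P: "P \<in> borel \<rightarrow>\<^sub>M prob_algebra borel" and gs: "list_all unit_fun gs" and h: "unit_fun h"
    and n: "n = length gs"
  shows "(\<integral>\<omega>. (\<Prod>i<n. (gs ! i) (\<omega> i)) * h (\<omega> n) \<partial>chain_law P x) =
    (\<integral>\<omega>. (\<Prod>i<n. (gs ! i) (\<omega> i)) * (\<integral>y. h y \<partial>chain_step P x n \<omega>) \<partial>chain_law P x)"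
proof -
  let ?P = "\<lambda>n. PiM {0..<n} (\<lambda>_. borel :: 'a measure)"
  interpret IT: Ionescu_Tulcea "chain_step P x" "\<lambda>_. borel"
    by (rule Ionescu_Tulcea_chain_step[OF P])
  interpret prob_space "chain_law P x"
    by (rule prob_space_chain_law[OF P])
  define D where "D n = distr (chain_law P x) (?P n) (\<lambda>\<omega>. restrict \<omega> {0..<n})" for n
  define G where "G \<omega> = (\<Prod>i<n. (gs ! i) (\<omega> i))" for \<omega>
  have r[measurable]: "(\<lambda>\<omega>. restrict \<omega> {0..<m}) \<in> chain_law P x \<rightarrow>\<^sub>M ?P m" for m
    by (auto intro!: measurable_restrict simp: measurable_cong_sets[OF sets_chain_law[OF P] refl])
  have G[measurable]: "G \<in> borel_measurable (?P m)" if "n \<le> m" for m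
    unfolding G_def
  proof (intro borel_measurable_prod)
    fix i assume i: "i \<in> {..<n}"
    then have "gs ! i \<in> borel_measurable borel"
      using gs n by (auto simp: list_all_length unit_fun_def)
    then show "(\<lambda>\<omega>. (gs ! i) (\<omega> i)) \<in> borel_measurable (?P m)"
      by (rule measurable_compose[rotated]) (use i that in \<open>auto intro!: measurable_component_singleton\<close>)
  qed
  have G_bounds: "0 \<le> G \<omega>" "G \<omega> \<le> 1" for \<omega>
    using path_prod_bounds[OF gs, of \<omega>] by (simp_all add: G_def n)
  have G_restrict: "G (restrict \<omega> {0..<m}) = G \<omega>" if "n \<le> m" for \<omega> m
    unfolding G_def using that by (intro prod.cong) auto
  have [measurable]: "h \<in> borel_measurable borel"
    using h by (rule unit_funD)
  have F: "(\<lambda>\<omega>. G \<omega> * h (\<omega> n)) \<in> borel_measurable (?P (Suc n))"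
    using G[of "Suc n"] by measurable
  have step: "(\<integral>\<omega>'. G \<omega>' * h (\<omega>' n) \<partial>IT.eP n \<omega>) = G \<omega> * (\<integral>y. h y \<partial>chain_step P x n \<omega>)"
    if \<omega>: "\<omega> \<in> space (?P n)" for \<omega>
  proof -
    have sets: "sets (chain_step P x n \<omega>) = sets borel"
      using IT.P[of n] \<omega> by (rule sets_kernel)
    have "fun_upd \<omega> n \<in> chain_step P x n \<omega> \<rightarrow>\<^sub>M ?P (Suc n)"
      unfolding measurable_cong_sets[OF sets refl] atLeast0_lessThan_Suc
      by (rule measurable_component_update[OF \<omega>]) simp
    from integral_distr[OF this F] have "(\<integral>\<omega>'. G \<omega>' * h (\<omega>' n) \<partial>IT.eP n \<omega>) =
        (\<integral>y. G (fun_upd \<omega> n y) * h y \<partial>chain_step P x n \<omega>)"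
      by (simp add: IT.eP_def)
    moreover have "G (fun_upd \<omega> n y) = G \<omega>" for y
      unfolding G_def by (intro prod.cong) auto
    ultimately show ?thesis
      by simp
  qed
  have K: "IT.eP n \<in> D n \<rightarrow>\<^sub>M subprob_algebra (?P (Suc n))"
    using IT.measurable_eP[of n] by (simp add: D_def)
  have D_Suc: "D (Suc n) = D n \<bind> IT.eP n"
    using distr_chain_law_Suc[OF P, of x n] by (simp add: D_def IT.eP_def[abs_def])
  have "(\<integral>\<omega>. G \<omega> * h (\<omega> n) \<partial>chain_law P x) = (\<integral>\<omega>. G \<omega> * h (\<omega> n) \<partial>D (Suc n))"
    unfolding D_def by (subst integral_distr[OF r F]) (simp add: G_restrict)
  also have "\<dots> = (\<integral>\<omega>. \<integral>\<omega>'. G \<omega>' * h (\<omega>' n) \<partial>IT.eP n \<omega> \<partial>D n)"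
    unfolding D_Suc
  proof (rule integral_bind[OF F _ K, where B = 1 and B' = 1])
    show "\<bar>G \<omega> * h (\<omega> n)\<bar> \<le> 1" for \<omega>
      using G_bounds[of \<omega>] unit_funD(2,3)[OF h, of "\<omega> n"] by (simp add: abs_mult mult_le_one)
    show "finite_measure (D n)"
      unfolding D_def by (rule finite_measure_distr) (rule r)
    show "AE \<omega> in D n. emeasure (IT.eP n \<omega>) (space (IT.eP n \<omega>)) \<le> ennreal 1"
      using IT.prob_space_eP by (intro AE_I2) (auto simp: D_def prob_space.emeasure_space_1)
  qed
  also have "\<dots> = (\<integral>\<omega>. G \<omega> * (\<integral>y. h y \<partial>chain_step P x n \<omega>) \<partial>D n)"
    by (intro Bochner_Integration.integral_cong refl step) (simp add: D_def)
  also have "\<dots> = (\<integral>\<omega>. G \<omega> * (\<integral>y. h y \<partial>chain_step P x n \<omega>) \<partial>chain_law P x)"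
    unfolding D_def
  proof (subst integral_distr[OF r])
    show "(\<lambda>\<omega>. G \<omega> * (\<integral>y. h y \<partial>chain_step P x n \<omega>)) \<in> borel_measurable (?P n)"
      using G[of n] measurable_compose[OF IT.P[of n] integral_measurable_subprob_algebra[of h borel]]
      by simp
    have "chain_step P x n (restrict \<omega> {0..<n}) = chain_step P x n \<omega>" for \<omega>
      by (simp add: chain_step_def split: nat.split)
    then show "(\<integral>\<omega>. G (restrict \<omega> {0..<n}) * (\<integral>y. h y \<partial>chain_step P x n (restrict \<omega> {0..<n})) \<partial>chain_law P x) =
        (\<integral>\<omega>. G \<omega> * (\<integral>y. h y \<partial>chain_step P x n \<omega>) \<partial>chain_law P x)"
      by (simp add: G_restrict)
  qed
  finally show ?thesis
    by (simp add: G_def)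
qed

text \<open>
  The path law is built by appending one coordinate at a time, whereas \<open>chain_expect\<close> conditions on
  the first step. The induction therefore peels off the last factor and absorbs its conditional
  expectation into the factor before it.
\<close>
lemma integral_chain_law_prod:
  fixes P :: "'a::polish_space \<Rightarrow> 'a measure"
  assumes P: "P \<in> borel \<rightarrow>\<^sub>M prob_algebra borel" and gs: "list_all unit_fun gs"
  shows "(\<integral>\<omega>. (\<Prod>i<length gs. (gs ! i) (\<omega> i)) \<partial>chain_law P x) = chain_expect P gs x"
  using gs
proof (induction "length gs" arbitrary: gs)
  case 0
  then show ?case
    using prob_space.prob_space[OF prob_space_chain_law[OF P], of x] by simp
next
  case (Suc n)
  obtain hs h where gs: "gs = hs @ [h]"
    using Suc.hyps(2) by (cases gs rule: rev_cases) auto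
  have hs: "list_all unit_fun hs" and h: "unit_fun h" and len: "length hs = n"
    using Suc.prems Suc.hyps(2) by (auto simp: gs)
  have split: "(\<integral>\<omega>. (\<Prod>i<length gs. (gs ! i) (\<omega> i)) \<partial>chain_law P x) =
      (\<integral>\<omega>. (\<Prod>i<n. (hs ! i) (\<omega> i)) * (\<integral>y. h y \<partial>chain_step P x n \<omega>) \<partial>chain_law P x)"
  proof -
    have "(\<Prod>i<length gs. (gs ! i) (\<omega> i)) = (\<Prod>i<n. (hs ! i) (\<omega> i)) * h (\<omega> n)" for \<omega>
      by (simp add: gs len nth_append)
    then show ?thesis
      using integral_chain_law_step[OF P hs h, of n] by (simp add: len)
  qed
  show ?case
  proof (cases hs rule: rev_cases)
    case Nil
    then have "(\<integral>\<omega>. (\<Prod>i<length gs. (gs ! i) (\<omega> i)) \<partial>chain_law P x) = (\<integral>y. h y \<partial>return borel x)"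
      using split len prob_space.prob_space[OF prob_space_chain_law[OF P], of x]
      by (simp add: chain_step_def)
    also have "\<dots> = h x"
      using h by (intro integral_return) (auto simp: unit_fun_def)
    finally show ?thesis
      by (simp add: gs Nil kernel_measure_1[OF P])
  next
    case (snoc hs' g)
    define k where "k y = g y * (\<integral>z. h z \<partial>P y)" for y
    have g: "unit_fun g" and hs': "list_all unit_fun hs'" and len': "n = Suc (length hs')"
      using hs len by (auto simp: snoc)
    have k: "unit_fun k"
      unfolding k_def by (intro unit_fun_mult g unit_fun_kernel[OF P] h)
    have "(\<Prod>i<n. (hs ! i) (\<omega> i)) * (\<integral>y. h y \<partial>chain_step P x n \<omega>) =
        (\<Prod>i<length (hs' @ [k]). ((hs' @ [k]) ! i) (\<omega> i))" for \<omega>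
      by (simp add: len' snoc nth_append chain_step_def k_def)
    then have "(\<integral>\<omega>. (\<Prod>i<length gs. (gs ! i) (\<omega> i)) \<partial>chain_law P x) = chain_expect P (hs' @ [k]) x"
      using split Suc.hyps(1)[of "hs' @ [k]"] hs' k len' by simp
    also have "\<dots> = chain_expect P (hs' @ [g, h]) x"
      using chain_append[OF P, of hs' "[g, h]" x] kernel_measure_1[OF P] by (simp add: k_def[abs_def])
    finally show ?thesis
      by (simp add: gs snoc)
  qed
qed

section \<open>Couplings make the late coins overlap\<close>
lemma prod_coins:
  fixes p :: "nat \<Rightarrow> 'a \<Rightarrow> real"
  defines "gs \<equiv> \<lambda>d m zs. replicate d (\<lambda>_. 1) @ coins p (m + d) zs"
  shows "(\<Prod>i<length (gs d m zs). (gs d m zs ! i) (\<omega> i)) = (\<Prod>i<length zs.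
    if zs ! i then p (m + d + i) (\<omega> (d + i)) else 1 - p (m + d + i) (\<omega> (d + i)))"
proof -
  have split: "(\<Prod>i<d + l. f i) = (\<Prod>i<d. f i) * (\<Prod>i<l. f (d + i))" for f :: "nat \<Rightarrow> real" and l
    by (induction l) simp_all
  have "(\<Prod>i<d. (gs d m zs ! i) (\<omega> i)) = 1"
    by (intro prod.neutral ballI) (simp add: gs_def nth_append)
  moreover have "(gs d m zs ! (d + i)) (\<omega> (d + i)) =
      (if zs ! i then p (m + d + i) (\<omega> (d + i)) else 1 - p (m + d + i) (\<omega> (d + i)))"
    if "i < length zs" for i
    using that by (simp add: gs_def nth_append nth_coins coin_prob_def)
  moreover have "length (gs d m zs) = d + length zs"
    by (simp add: gs_def)
  ultimately show ?thesis
    by (simp only: split mult_1) (auto intro!: prod.cong)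
qed

text \<open>
  The event \<open>G d\<close> that the squared distances after time \<open>d\<close> sum to at most \<open>1\<close> increases to the event
  that the whole sum is finite, so it has probability above \<open>\<alpha>/2\<close> for large \<open>d\<close>. There the coins of
  the two paths overlap by \<open>1/4\<close>, and integrating over the coupling preserves this, since the minimum
  of two integrals dominates the integral of the minimum.
\<close>
lemma coupling_overlap:
  fixes P :: "'a::polish_space \<Rightarrow> 'a measure" and f :: "nat \<Rightarrow> 'a \<Rightarrow> real"
  assumes P: "P \<in> borel \<rightarrow>\<^sub>M prob_algebra borel" and \<alpha>: "0 < \<alpha>"
    and Q: "Q \<in> couplings (chain_law P x) (chain_law P x')"
    and \<alpha>_le: "\<alpha> \<le> measure Q {\<omega> \<in> space Q. summable (\<lambda>n. (dist (fst \<omega> n) (snd \<omega> n))\<^sup>2)}"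
    and f: "\<And>k. f k \<in> Lip" and p: "p = (\<lambda>k x. 1/2 + f k x / 4)" and p_unit: "\<And>k. unit_fun (p k)"
  shows "\<forall>\<^sub>F d in sequentially. \<forall>l. \<alpha> / 8 \<le> (\<Sum>zs\<in>words l.
    min (chain_expect P (replicate d (\<lambda>_. 1) @ coins p (m + d) zs) x)
        (chain_expect P (replicate d (\<lambda>_. 1) @ coins p (m + d) zs) x'))"
proof -
  have sets_Q: "sets Q = sets (path_space \<Otimes>\<^sub>M path_space)"
    using Q sets_pair_measure_cong[OF sets_chain_law[OF P] sets_chain_law[OF P], of x x']
    by (simp add: couplings_def space_prob_algebra)
  have "prob_space Q" and fst_Q: "distr Q (chain_law P x) fst = chain_law P x"
    and snd_Q: "distr Q (chain_law P x') snd = chain_law P x'"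
    using Q by (auto simp: couplings_def space_prob_algebra)
  interpret prob_space Q by fact
  note [measurable_cong] = sets_Q
  have fst_meas: "fst \<in> Q \<rightarrow>\<^sub>M chain_law P x" and snd_meas: "snd \<in> Q \<rightarrow>\<^sub>M chain_law P x'"
    by (simp_all add: measurable_cong_sets[OF sets_Q sets_chain_law[OF P]])
  have space_Q: "space Q = UNIV"
    using sets_eq_imp_space_eq[OF sets_Q] by (simp add: space_pair_measure space_PiM)
  define \<Delta> where "\<Delta> n \<omega> = (dist (fst \<omega> n) (snd \<omega> n))\<^sup>2" for n and \<omega> :: "(nat \<Rightarrow> 'a) \<times> (nat \<Rightarrow> 'a)"
  have \<Delta>_nonneg: "0 \<le> \<Delta> n \<omega>" for n \<omega>
    by (simp add: \<Delta>_def)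
  have [measurable]: "\<Delta> n \<in> borel_measurable Q" for n
    unfolding \<Delta>_def by measurable
  define G where "G d = {\<omega> \<in> space Q. \<forall>l. (\<Sum>i<l. \<Delta> (d + i) \<omega>) \<le> 1}" for d
  have G_meas [measurable]: "G d \<in> sets Q" for d
    unfolding G_def by measurable
  have "G d \<subseteq> G (Suc d)" for d
  proof
    fix \<omega> assume \<omega>: "\<omega> \<in> G d"
    have "(\<Sum>i<l. \<Delta> (Suc d + i) \<omega>) \<le> 1" for l
    proof -
      have "(\<Sum>i<Suc l. \<Delta> (d + i) \<omega>) = \<Delta> d \<omega> + (\<Sum>i<l. \<Delta> (Suc d + i) \<omega>)"
        by (subst sum.lessThan_Suc_shift) simp
      moreover have "(\<Sum>i<Suc l. \<Delta> (d + i) \<omega>) \<le> 1"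
        using \<omega> unfolding G_def by blast
      ultimately show ?thesis
        using \<Delta>_nonneg[of d \<omega>] by linarith
    qed
    then show "\<omega> \<in> G (Suc d)"
      using \<omega> by (simp add: G_def)
  qed
  then have "incseq G"
    by (rule incseq_SucI)
  moreover have "(\<Union>d. G d) = {\<omega> \<in> space Q. summable (\<lambda>n. \<Delta> n \<omega>)}"
  proof (intro equalityI subsetI)
    fix \<omega> assume "\<omega> \<in> (\<Union>d. G d)"
    then obtain d where d: "\<And>l. (\<Sum>i<l. \<Delta> (d + i) \<omega>) \<le> 1"
      by (auto simp: G_def)
    have "summable (\<lambda>i. \<Delta> (i + d) \<omega>)"
      using d by (intro summableI_nonneg_bounded[where x = 1] \<Delta>_nonneg) (simp add: add.commute)
    then show "\<omega> \<in> {\<omega> \<in> space Q. summable (\<lambda>n. \<Delta> n \<omega>)}"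
      using summable_iff_shift[of "\<lambda>n. \<Delta> n \<omega>" d] by (simp add: space_Q)
  next
    fix \<omega> assume "\<omega> \<in> {\<omega> \<in> space Q. summable (\<lambda>n. \<Delta> n \<omega>)}"
    then have sm: "summable (\<lambda>n. \<Delta> n \<omega>)"
      by simp
    obtain d where d: "norm (\<Sum>i. \<Delta> (i + d) \<omega>) < 1"
      using suminf_exist_split[OF zero_less_one sm] by blast
    have "(\<Sum>i<l. \<Delta> (d + i) \<omega>) \<le> (\<Sum>i. \<Delta> (i + d) \<omega>)" for l
      using sum_le_suminf[of "\<lambda>i. \<Delta> (i + d) \<omega>" "{..<l}"] sm summable_iff_shift[of "\<lambda>n. \<Delta> n \<omega>" d]
      by (simp add: \<Delta>_nonneg add.commute)
    moreover have "(\<Sum>i. \<Delta> (i + d) \<omega>) \<le> 1"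
      using d unfolding real_norm_def by linarith
    ultimately have "(\<Sum>i<l. \<Delta> (d + i) \<omega>) \<le> 1" for l
      using order_trans by blast
    then have "\<omega> \<in> G d"
      by (simp add: G_def space_Q)
    then show "\<omega> \<in> (\<Union>d. G d)"
      by blast
  qed
  ultimately have "(\<lambda>d. measure Q (G d)) \<longlonglongrightarrow> measure Q {\<omega> \<in> space Q. summable (\<lambda>n. \<Delta> n \<omega>)}"
    using finite_Lim_measure_incseq[of G] image_subsetI[of UNIV G "sets Q"] G_meas by simp
  moreover have "\<alpha> / 2 < measure Q {\<omega> \<in> space Q. summable (\<lambda>n. \<Delta> n \<omega>)}"
    using \<alpha> \<alpha>_le by (simp add: \<Delta>_def)
  ultimately have "\<forall>\<^sub>F d in sequentially. \<alpha> / 2 < measure Q (G d)"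
    by (rule order_tendstoD)
  then show ?thesis
  proof (eventually_elim, intro allI)
    fix d l assume d: "\<alpha> / 2 < measure Q (G d)"
    define gs where "gs zs = replicate d (\<lambda>_. 1) @ coins p (m + d) zs" for zs
    have gs: "list_all unit_fun (gs zs)" for zs
      by (simp add: gs_def unit_fun_replicate unit_fun_coins p_unit)
    define B where "B zs \<omega> = (\<Prod>i<length (gs zs). (gs zs ! i) (\<omega> i))" for zs and \<omega> :: "nat \<Rightarrow> 'a"
    have B_meas: "B zs \<in> borel_measurable path_space" for zs
      unfolding B_def by (rule measurable_path_prod[OF gs])
    have B_bounds: "0 \<le> B zs \<omega>" "B zs \<omega> \<le> 1" for zs \<omega>
      unfolding B_def by (rule path_prod_bounds[OF gs])+
    have int1: "integrable Q (\<lambda>\<omega>. B zs (fst \<omega>))" and int2: "integrable Q (\<lambda>\<omega>. B zs (snd \<omega>))" for zs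
      using B_meas B_bounds by (auto intro!: integrable_const_bound[where B = 1])
    have e1: "chain_expect P (gs zs) x = (\<integral>\<omega>. B zs (fst \<omega>) \<partial>Q)" for zs
    proof -
      have "chain_expect P (gs zs) x = (\<integral>\<omega>. B zs \<omega> \<partial>distr Q (chain_law P x) fst)"
        unfolding fst_Q B_def by (rule integral_chain_law_prod[OF P gs, symmetric])
      then show ?thesis
        using integral_distr[OF fst_meas, of "B zs"] B_meas
        by (simp add: measurable_cong_sets[OF sets_chain_law[OF P] refl])
    qed
    have e2: "chain_expect P (gs zs) x' = (\<integral>\<omega>. B zs (snd \<omega>) \<partial>Q)" for zs
    proof -
      have "chain_expect P (gs zs) x' = (\<integral>\<omega>. B zs \<omega> \<partial>distr Q (chain_law P x') snd)"
        unfolding snd_Q B_def by (rule integral_chain_law_prod[OF P gs, symmetric])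
      then show ?thesis
        using integral_distr[OF snd_meas, of "B zs"] B_meas
        by (simp add: measurable_cong_sets[OF sets_chain_law[OF P] refl])
    qed
    have on_G: "indicator (G d) \<omega> * (1/4) \<le> (\<Sum>zs\<in>words l. min (B zs (fst \<omega>)) (B zs (snd \<omega>)))" for \<omega>
    proof (cases "\<omega> \<in> G d")
      case True
      define u v where "u i = p (m + d + i) (fst \<omega> (d + i))" and "v i = p (m + d + i) (snd \<omega> (d + i))" for i
      have range: "p k y \<in> {1/4..3/4}" for k y
      proof -
        have "\<bar>f k y\<bar> \<le> 1"
          using f[of k] by (simp add: Lip_def)
        then show ?thesis
          unfolding p atLeastAtMost_iff by linarith
      qed
      have "(4 * (u i - v i))\<^sup>2 \<le> \<Delta> (d + i) \<omega>" for i
      proof -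
        have "4 * (u i - v i) = f (m + d + i) (fst \<omega> (d + i)) - f (m + d + i) (snd \<omega> (d + i))"
          by (simp add: u_def v_def p field_simps)
        moreover have "\<bar>f (m + d + i) (fst \<omega> (d + i)) - f (m + d + i) (snd \<omega> (d + i))\<bar>
            \<le> \<bar>dist (fst \<omega> (d + i)) (snd \<omega> (d + i))\<bar>"
          using f[of "m + d + i"] by (simp add: Lip_def)
        ultimately show ?thesis
          unfolding \<Delta>_def by (simp only: abs_le_square_iff)
      qed
      then have "(\<Sum>i<l. (4 * (u i - v i))\<^sup>2) \<le> (\<Sum>i<l. \<Delta> (d + i) \<omega>)"
        by (rule sum_mono)
      also have "\<dots> \<le> 1"
        using True unfolding G_def by blast
      finally have "1/4 \<le> (\<Sum>zs\<in>words l. min (\<Prod>i<l. if zs ! i then u i else 1 - u i)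
          (\<Prod>i<l. if zs ! i then v i else 1 - v i))"
        using range by (intro coin_overlap) (simp_all only: u_def v_def)
      also have "\<dots> = (\<Sum>zs\<in>words l. min (B zs (fst \<omega>)) (B zs (snd \<omega>)))"
        unfolding B_def gs_def prod_coins u_def v_def by (intro sum.cong refl) (simp add: words_def)
      finally show ?thesis
        using True by simp
    next
      case False
      then show ?thesis
        by (auto intro!: sum_nonneg simp: B_bounds)
    qed
    have int_min: "integrable Q (\<lambda>\<omega>. min (B zs (fst \<omega>)) (B zs (snd \<omega>)))" for zs
      by (intro integrable_min int1 int2)
    have int_G: "integrable Q (\<lambda>\<omega>. indicator (G d) \<omega> * (1/4) :: real)"
      by (intro integrable_mult_left integrable_real_indicator G_meas) (simp add: emeasure_eq_measure)
    have "\<alpha> / 8 \<le> (\<integral>\<omega>. indicator (G d) \<omega> * (1/4) \<partial>Q)"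
      using d by simp
    also have "\<dots> \<le> (\<integral>\<omega>. (\<Sum>zs\<in>words l. min (B zs (fst \<omega>)) (B zs (snd \<omega>))) \<partial>Q)"
      by (intro integral_mono int_G Bochner_Integration.integrable_sum int_min on_G)
    also have "\<dots> = (\<Sum>zs\<in>words l. \<integral>\<omega>. min (B zs (fst \<omega>)) (B zs (snd \<omega>)) \<partial>Q)"
      by (rule Bochner_Integration.integral_sum[OF int_min])
    also have "\<dots> \<le> (\<Sum>zs\<in>words l. min (\<integral>\<omega>. B zs (fst \<omega>) \<partial>Q) (\<integral>\<omega>. B zs (snd \<omega>) \<partial>Q))"
      by (intro sum_mono min.boundedI integral_mono int_min int1 int2) auto
    finally show "\<alpha> / 8 \<le> (\<Sum>zs\<in>words l.
        min (chain_expect P (replicate d (\<lambda>_. 1) @ coins p (m + d) zs) x)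
            (chain_expect P (replicate d (\<lambda>_. 1) @ coins p (m + d) zs) x'))"
      by (simp add: gs_def[symmetric] e1 e2)
  qed
qed

section \<open>Weak ergodicity\<close>
definition mean_measure :: "'a measure \<Rightarrow> 'a measure \<Rightarrow> 'a measure" where
  "mean_measure \<mu> \<nu> = measure_pmf (bernoulli_pmf (1/2)) \<bind> (\<lambda>b. if b then \<mu> else \<nu>)"

lemma mean_measure:
  fixes \<mu> \<nu> :: "'a::topological_space measure"
  assumes \<mu>: "\<mu> \<in> space (prob_algebra borel)" and \<nu>: "\<nu> \<in> space (prob_algebra borel)"
  shows "mean_measure \<mu> \<nu> \<in> space (prob_algebra borel)"
    and "unit_fun f \<Longrightarrow> (\<integral>x. f x \<partial>mean_measure \<mu> \<nu>) = ((\<integral>x. f x \<partial>\<mu>) + (\<integral>x. f x \<partial>\<nu>)) / 2"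
proof -
  have B: "measure_pmf (bernoulli_pmf (1/2)) \<in> space (prob_algebra (count_space UNIV))"
    by (simp add: space_prob_algebra measure_pmf.prob_space_axioms)
  have K: "(\<lambda>b. if b then \<mu> else \<nu>) \<in> count_space UNIV \<rightarrow>\<^sub>M prob_algebra borel"
    using \<mu> \<nu> by simp
  show "mean_measure \<mu> \<nu> \<in> space (prob_algebra borel)"
    unfolding mean_measure_def
    using measurable_bind_prob_space[OF measurable_const[OF B] K, THEN measurable_space,
        of undefined "count_space UNIV"] by simp
  assume f: "unit_fun f"
  have "(\<integral>x. f x \<partial>mean_measure \<mu> \<nu>) =
      (\<integral>b. (\<integral>x. f x \<partial>(if b then \<mu> else \<nu>)) \<partial>bernoulli_pmf (1/2))"
    unfolding mean_measure_def
  proof (rule integral_bind[where K = borel and B = 1 and B' = 1])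
    show "(\<lambda>b. if b then \<mu> else \<nu>) \<in> bernoulli_pmf (1/2) \<rightarrow>\<^sub>M subprob_algebra borel"
      using measurable_prob_algebraD[OF K] by simp
    show "AE b in bernoulli_pmf (1/2). emeasure (if b then \<mu> else \<nu>) (space (if b then \<mu> else \<nu>)) \<le> ennreal 1"
      using \<mu> \<nu> by (intro AE_I2) (auto simp: space_prob_algebra prob_space.emeasure_space_1)
  qed (use f in \<open>auto simp: unit_fun_def measure_pmf.finite_measure\<close>)
  then show "(\<integral>x. f x \<partial>mean_measure \<mu> \<nu>) = ((\<integral>x. f x \<partial>\<mu>) + (\<integral>x. f x \<partial>\<nu>)) / 2"
    by simp
qed

lemma Lip_continuous: "f \<in> Lip \<Longrightarrow> continuous_on UNIV f"
  unfolding continuous_on_iff Lip_def dist_real_def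
  by (metis (mono_tags, lifting) UNIV_I le_less_trans mem_Collect_eq)

lemma kernel_iterate_prob:
  assumes P: "P \<in> borel \<rightarrow>\<^sub>M prob_algebra borel" and \<mu>: "\<mu> \<in> space (prob_algebra borel)"
  shows "kernel_iterate P n \<mu> \<in> space (prob_algebra borel)"
proof (induction n)
  case 0
  show ?case
    using \<mu> by (simp add: kernel_iterate_def)
next
  case (Suc n)
  show ?case
    using measurable_bind_prob_space[OF measurable_const[OF Suc] P, THEN measurable_space, of undefined borel]
    by (simp add: kernel_iterate_def)
qed

lemma Lip_integral_diff_tendsto:
  fixes P :: "'a::polish_space \<Rightarrow> 'a measure" and f :: "nat \<Rightarrow> 'a \<Rightarrow> real"
  assumes P: "P \<in> borel \<rightarrow>\<^sub>M prob_algebra borel" and \<alpha>: "0 < \<alpha>"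
    and couplings: "\<And>x x'. \<exists>Q \<in> couplings (chain_law P x) (chain_law P x').
      \<alpha> \<le> measure Q {\<omega> \<in> space Q. summable (\<lambda>n. (dist (fst \<omega> n) (snd \<omega> n))\<^sup>2)}"
    and \<mu>: "\<mu> \<in> space (prob_algebra borel)" and \<nu>: "\<nu> \<in> space (prob_algebra borel)"
    and f: "\<And>n. f n \<in> Lip"
  shows "(\<lambda>n. (\<integral>x. f n x \<partial>kernel_iterate P n \<mu>) - (\<integral>x. f n x \<partial>kernel_iterate P n \<nu>)) \<longlonglongrightarrow> 0"
proof -
  define p where "p = (\<lambda>n x. 1/2 + f n x / 4)"
  have f_meas: "f n \<in> borel_measurable borel" for n
    using Lip_continuous[OF f] by (rule borel_measurable_continuous_onI)
  have f_bound: "\<bar>f n x\<bar> \<le> 1" for n x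
    using f[of n] by (simp add: Lip_def)
  have p: "unit_fun (p n)" for n
    unfolding unit_fun_def
  proof (intro conjI allI)
    show "p n \<in> borel_measurable borel"
      unfolding p_def using f_meas[of n] by measurable
    show "0 \<le> p n x" "p n x \<le> 1" for x
      using f_bound[of n x] by (auto simp: p_def abs_le_iff)
  qed
  have prob: "prob_space \<rho>" "sets \<rho> = sets borel" if "\<rho> \<in> space (prob_algebra borel)"
    for \<rho> :: "'a measure"
    using that by (auto simp: space_prob_algebra)
  let ?\<rho> = "mean_measure \<mu> \<nu>"
  note mean = mean_measure[OF \<mu> \<nu>]
  have "mixing (\<alpha> / 8 / 2) (word_prob P p ?\<rho>)"
  proof (rule mixing_word_prob[OF P p prob[OF mean(1)]])
    fix m x y
    obtain Q where Q: "Q \<in> couplings (chain_law P x) (chain_law P y)"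
      "\<alpha> \<le> measure Q {\<omega> \<in> space Q. summable (\<lambda>n. (dist (fst \<omega> n) (snd \<omega> n))\<^sup>2)}"
      using couplings by blast
    show "\<forall>\<^sub>F d in sequentially. \<forall>l. \<alpha> / 8 \<le> (\<Sum>zs\<in>words l.
        min (chain_expect P (replicate d (\<lambda>_. 1) @ coins p (m + d) zs) x)
            (chain_expect P (replicate d (\<lambda>_. 1) @ coins p (m + d) zs) y))"
      by (rule coupling_overlap[OF P \<alpha> Q f p_def p])
  qed (use \<alpha> in simp)
  moreover have "word_prob P p ?\<rho> = (\<lambda>n xs. (word_prob P p \<mu> n xs + word_prob P p \<nu> n xs) / 2)"
    unfolding word_prob_def
    by (intro ext mean(2) unit_fun_chain[OF P]) (simp add: unit_fun_replicate unit_fun_coins p)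
  ultimately have "mixing (\<alpha> / 8 / 2) (\<lambda>n xs. (word_prob P p \<mu> n xs + word_prob P p \<nu> n xs) / 2)"
    by simp
  from mixing_imp_indistinguishable[OF consistent_word_prob[OF P p prob[OF \<mu>]]
      consistent_word_prob[OF P p prob[OF \<nu>]] _ this] \<alpha>
  have lim: "(\<lambda>n. word_prob P p \<mu> n [True] - word_prob P p \<nu> n [True]) \<longlonglongrightarrow> 0"
    by simp
  have toss: "word_prob P p \<rho> n [True] = 1/2 + (\<integral>x. f n x \<partial>kernel_iterate P n \<rho>) / 4"
    if \<rho>: "\<rho> \<in> space (prob_algebra borel)" for \<rho> n
  proof -
    interpret prob_space "kernel_iterate P n \<rho>"
      using prob(1)[OF kernel_iterate_prob[OF P \<rho>]] .
    have "f n \<in> borel_measurable (kernel_iterate P n \<rho>)"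
      using f_meas by (simp add: measurable_cong_sets[OF prob(2)[OF kernel_iterate_prob[OF P \<rho>]] refl])
    then have "integrable (kernel_iterate P n \<rho>) (f n)"
      using f_bound by (intro integrable_const_bound[where B = 1]) auto
    then have "(\<integral>x. p n x \<partial>kernel_iterate P n \<rho>) = 1/2 + (\<integral>x. f n x \<partial>kernel_iterate P n \<rho>) / 4"
      by (simp add: p_def prob_space)
    then show ?thesis
      using integral_kernel_iterate[OF P prob[OF \<rho>] p[of n]]
      by (simp add: word_prob_def coin_prob_def)
  qed
  from tendsto_mult[OF tendsto_const[of 4] lim] show ?thesis
    by (simp add: toss[OF \<mu>] toss[OF \<nu>] algebra_simps)
qed

text \<open>
  Choosing for each \<open>n\<close> a function that attains the supremum up to \<open>1/(n+1)\<close> reduces the norm to a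
  single sequence of functions.
\<close>
theorem theorem2p11:
  fixes P :: "'a::polish_space \<Rightarrow> 'a measure"
  assumes "P \<in> borel \<rightarrow>\<^sub>M prob_algebra borel"
    and "\<exists>\<alpha>>0. \<forall>x x'. \<exists>Q \<in> couplings (chain_law P x) (chain_law P x').
      measure Q {\<omega> \<in> space Q. summable (\<lambda>n. (dist (fst \<omega> n) (snd \<omega> n))\<^sup>2)} \<ge> \<alpha>"
  shows "\<forall>\<mu> \<in> space (prob_algebra borel). \<forall>\<nu> \<in> space (prob_algebra borel).
    (\<lambda>n. BL_norm_diff (kernel_iterate P n \<mu>) (kernel_iterate P n \<nu>)) \<longlonglongrightarrow> 0"
proof (intro ballI)
  fix \<mu> \<nu> :: "'a measure"
  assume \<mu>: "\<mu> \<in> space (prob_algebra borel)" and \<nu>: "\<nu> \<in> space (prob_algebra borel)"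
  obtain \<alpha> where \<alpha>: "0 < \<alpha>" and couplings: "\<And>x x'. \<exists>Q \<in> couplings (chain_law P x) (chain_law P x').
      \<alpha> \<le> measure Q {\<omega> \<in> space Q. summable (\<lambda>n. (dist (fst \<omega> n) (snd \<omega> n))\<^sup>2)}"
    using assms(2) by blast
  define gap where "gap n f = \<bar>(\<integral>x. f x \<partial>kernel_iterate P n \<mu>) - (\<integral>x. f x \<partial>kernel_iterate P n \<nu>)\<bar>"
    for n and f :: "'a \<Rightarrow> real"
  define BL where "BL n = BL_norm_diff (kernel_iterate P n \<mu>) (kernel_iterate P n \<nu>)" for n
  have BL: "BL n = (SUP f\<in>Lip. gap n f)" for n
    by (simp add: BL_def BL_norm_diff_def gap_def)
  have bdd: "bdd_above (gap n ` Lip)" for n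
    unfolding gap_def
    by (rule bdd_above_BL[OF kernel_iterate_prob[OF assms(1) \<mu>] kernel_iterate_prob[OF assms(1) \<nu>]])
  have zero: "(\<lambda>_. 0) \<in> (Lip :: ('a \<Rightarrow> real) set)"
    by (simp add: Lip_def)
  have "\<exists>f\<in>Lip. BL n - 1 / real (Suc n) < gap n f" for n
  proof -
    have "BL n - 1 / real (Suc n) < (SUP f\<in>Lip. gap n f)"
      unfolding BL[symmetric] by simp
    then show ?thesis
      using zero less_cSUP_iff[OF _ bdd] by blast
  qed
  then obtain f where f: "\<And>n. f n \<in> Lip" "\<And>n. BL n - 1 / real (Suc n) < gap n (f n)"
    by metis
  have "(\<lambda>n. gap n (f n)) \<longlonglongrightarrow> 0"
    using tendsto_rabs[OF Lip_integral_diff_tendsto[OF assms(1) \<alpha> couplings \<mu> \<nu> f(1)]]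
    by (simp add: gap_def)
  then have "(\<lambda>n. gap n (f n) + 1 / real (Suc n)) \<longlonglongrightarrow> 0 + 0"
    by (intro tendsto_add LIMSEQ_Suc[OF lim_1_over_n])
  then have upper: "(\<lambda>n. gap n (f n) + 1 / real (Suc n)) \<longlonglongrightarrow> 0"
    by simp
  have "BL \<longlonglongrightarrow> 0"
  proof (rule tendsto_sandwich[OF _ _ tendsto_const upper])
    show "\<forall>\<^sub>F n in sequentially. 0 \<le> BL n"
      using cSUP_upper[OF zero bdd] by (simp add: BL gap_def)
    show "\<forall>\<^sub>F n in sequentially. BL n \<le> gap n (f n) + 1 / real (Suc n)"
      using f(2) by (intro always_eventually allI) (simp add: less_imp_le algebra_simps)
  qed
  then show "(\<lambda>n. BL_norm_diff (kernel_iterate P n \<mu>) (kernel_iterate P n \<nu>)) \<longlonglongrightarrow> 0"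
    by (simp add: BL_def[abs_def])
qed

end
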